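(* Let $\alpha_1,\alpha_2,\beta_1,\beta_2>0$ and let $(u,v)$ be a nonnegative classical solution of the Robin problem $$\begin{cases}\Delta[(d_1+a_{11}u)u]+u(1-u-a_1v)=0, & x\in\Omega,\\ \Delta[(d_2+a_{22}v)v]+v(1-a_2u-v)=0, & x\in\Omega,\\ \alpha_1u+\beta_1\dfrac{\partial u}{\partial\nu}=\alpha_2v+\beta_2\dfrac{\partial v}{\partial\nu}=0, & x\in\partial\Omega.\end{cases}$$ Suppose that either (i) $a_1>1>a_2$, $d_1>d_2$, $d_1\ge d_2+2a_{22}$, $\alpha_1\ge\beta_1$ and $\alpha_2\le\beta_2$, or (ii) $a_1<1<a_2$, $d_1<d_2$, $d_2\ge d_1+2a_{11}$, $\alpha_1\le\beta_1$ and $\alpha_2\ge\beta_2$. Then the system has no coexisting solutions, that is, $u\equiv0$ or $v\equiv0$ in $\Omega$.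
   Context: $\Omega\subset\mathbb{R}^n$ ($n\ge1$) is a bounded domain with smooth boundary satisfying the interior ball condition at every boundary point, and $\nu$ is the outward unit normal on $\partial\Omega$. The constants satisfy $a_1,a_2,d_1,d_2>0$ and $a_{11},a_{22}\ge0$. A nonnegative classical solution is a pair $(u,v)\in (C^1(\overline\Omega)\cap C^2(\Omega))^2$ with $u,v\ge0$ in $\overline\Omega$ satisfying the system (equations and boundary conditions) pointwise. A coexisting solution is a nonnegative classical solution with $u\not\equiv0$ and $v\not\equiv0$. *)

theory Defs
  imports "HOL-Analysis.Analysis"
begin

definition partial_deriv :: "'a::euclidean_space \<Rightarrow> ('a \<Rightarrow> real) \<Rightarrow> 'a \<Rightarrow> real" where
  "partial_deriv e f x = frechet_derivative f (at x) e"

definition grad :: "('a::euclidean_space \<Rightarrow> real) \<Rightarrow> 'a \<Rightarrow> 'a" where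
  "grad f x = (\<Sum>e\<in>Basis. partial_deriv e f x *\<^sub>R e)"

definition laplacian :: "('a::euclidean_space \<Rightarrow> real) \<Rightarrow> 'a \<Rightarrow> real" where
  "laplacian f x = (\<Sum>e\<in>Basis. partial_deriv e (partial_deriv e f) x)"

(* Only meaningful for open S. *)
primrec Ck_on :: "nat \<Rightarrow> ('a::euclidean_space \<Rightarrow> real) \<Rightarrow> 'a set \<Rightarrow> bool" where
  "Ck_on 0 f S \<longleftrightarrow> continuous_on S f"
| "Ck_on (Suc k) f S \<longleftrightarrow>
     f differentiable_on S \<and> (\<forall>e\<in>Basis. Ck_on k (partial_deriv e f) S)"

definition smooth_on :: "('a::euclidean_space \<Rightarrow> real) \<Rightarrow> 'a set \<Rightarrow> bool" where
  "smooth_on f S \<longleftrightarrow> (\<forall>k. Ck_on k f S)"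

(* The space C^1 of the closure of an open set S: C^1 functions on S that, together with
   their first derivatives, extend continuously to the closure.  Values of f outside the
   closure play no role, so the gradient is only taken at points of S. *)
definition C1_closure :: "('a::euclidean_space \<Rightarrow> real) \<Rightarrow> 'a set \<Rightarrow> bool" where
  "C1_closure f S \<longleftrightarrow>
     Ck_on 1 f S \<and> continuous_on (closure S) f \<and>
     (\<exists>G. continuous_on (closure S) G \<and> (\<forall>x\<in>S. G x = grad f x))"

(* At a boundary point the gradient is the value of its continuous extension from inside. *)
definition boundary_grad :: "'a::euclidean_space set \<Rightarrow> ('a \<Rightarrow> real) \<Rightarrow> 'a \<Rightarrow> 'a" where
  "boundary_grad S f x = Lim (at x within S) (grad f)"

definition normal_deriv ::
    "'a::euclidean_space set \<Rightarrow> ('a \<Rightarrow> 'a) \<Rightarrow> ('a \<Rightarrow> real) \<Rightarrow> 'a \<Rightarrow> real" where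
  "normal_deriv S \<nu> f x = boundary_grad S f x \<bullet> \<nu> x"

(* Near the boundary point p, the set S is the region where the smooth function phi is
   negative; the gradient of phi points out of S. *)
definition local_defining_function ::
    "'a::euclidean_space set \<Rightarrow> 'a \<Rightarrow> 'a set \<Rightarrow> ('a \<Rightarrow> real) \<Rightarrow> bool" where
  "local_defining_function S p U \<phi> \<longleftrightarrow>
     open U \<and> p \<in> U \<and> smooth_on \<phi> U \<and> (\<forall>x\<in>U. grad \<phi> x \<noteq> 0) \<and>
     S \<inter> U = {x\<in>U. \<phi> x < 0} \<and> frontier S \<inter> U = {x\<in>U. \<phi> x = 0}"

definition smooth_boundary :: "'a::euclidean_space set \<Rightarrow> bool" where
  "smooth_boundary S \<longleftrightarrow> (\<forall>p\<in>frontier S. \<exists>U \<phi>. local_defining_function S p U \<phi>)"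

definition interior_ball_condition :: "'a::euclidean_space set \<Rightarrow> bool" where
  "interior_ball_condition S \<longleftrightarrow>
     (\<forall>p\<in>frontier S. \<exists>c r. r > 0 \<and> ball c r \<subseteq> S \<and> p \<in> sphere c r)"

definition smooth_bounded_domain :: "'a::euclidean_space set \<Rightarrow> bool" where
  "smooth_bounded_domain S \<longleftrightarrow>
     open S \<and> connected S \<and> S \<noteq> {} \<and> bounded S \<and>
     smooth_boundary S \<and> interior_ball_condition S"

definition outward_unit_normal :: "'a::euclidean_space set \<Rightarrow> ('a \<Rightarrow> 'a) \<Rightarrow> bool" where
  "outward_unit_normal S \<nu> \<longleftrightarrow>
     (\<forall>p\<in>frontier S. \<exists>U \<phi>. local_defining_function S p U \<phi> \<and> \<nu> p = sgn (grad \<phi> p))"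

definition nonneg_classical_pair ::
    "'a::euclidean_space set \<Rightarrow> ('a \<Rightarrow> real) \<Rightarrow> ('a \<Rightarrow> real) \<Rightarrow> bool" where
  "nonneg_classical_pair \<Omega> u v \<longleftrightarrow>
     C1_closure u \<Omega> \<and> Ck_on 2 u \<Omega> \<and> C1_closure v \<Omega> \<and> Ck_on 2 v \<Omega> \<and>
     (\<forall>x\<in>closure \<Omega>. u x \<ge> 0 \<and> v x \<ge> 0)"

definition robin_system ::
    "'a::euclidean_space set \<Rightarrow> ('a \<Rightarrow> 'a) \<Rightarrow>
     real \<Rightarrow> real \<Rightarrow> real \<Rightarrow> real \<Rightarrow> real \<Rightarrow> real \<Rightarrow>
     real \<Rightarrow> real \<Rightarrow> real \<Rightarrow> real \<Rightarrow> ('a \<Rightarrow> real) \<Rightarrow> ('a \<Rightarrow> real) \<Rightarrow> bool" where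
  "robin_system \<Omega> \<nu> d1 d2 a11 a22 a1 a2 \<alpha>1 \<alpha>2 \<beta>1 \<beta>2 u v \<longleftrightarrow>
     (\<forall>x\<in>\<Omega>. laplacian (\<lambda>y. (d1 + a11 * u y) * u y) x + u x * (1 - u x - a1 * v x) = 0) \<and>
     (\<forall>x\<in>\<Omega>. laplacian (\<lambda>y. (d2 + a22 * v y) * v y) x + v x * (1 - a2 * u x - v x) = 0) \<and>
     (\<forall>x\<in>frontier \<Omega>. \<alpha>1 * u x + \<beta>1 * normal_deriv \<Omega> \<nu> u x = 0) \<and>
     (\<forall>x\<in>frontier \<Omega>. \<alpha>2 * v x + \<beta>2 * normal_deriv \<Omega> \<nu> v x = 0)"

definition nonneg_classical_solution ::
    "'a::euclidean_space set \<Rightarrow> ('a \<Rightarrow> 'a) \<Rightarrow>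
     real \<Rightarrow> real \<Rightarrow> real \<Rightarrow> real \<Rightarrow> real \<Rightarrow> real \<Rightarrow>
     real \<Rightarrow> real \<Rightarrow> real \<Rightarrow> real \<Rightarrow> ('a \<Rightarrow> real) \<Rightarrow> ('a \<Rightarrow> real) \<Rightarrow> bool" where
  "nonneg_classical_solution \<Omega> \<nu> d1 d2 a11 a22 a1 a2 \<alpha>1 \<alpha>2 \<beta>1 \<beta>2 u v \<longleftrightarrow>
     nonneg_classical_pair \<Omega> u v \<and>
     robin_system \<Omega> \<nu> d1 d2 a11 a22 a1 a2 \<alpha>1 \<alpha>2 \<beta>1 \<beta>2 u v"

definition coexisting_solution ::
    "'a::euclidean_space set \<Rightarrow> ('a \<Rightarrow> 'a) \<Rightarrow>
     real \<Rightarrow> real \<Rightarrow> real \<Rightarrow> real \<Rightarrow> real \<Rightarrow> real \<Rightarrow>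
     real \<Rightarrow> real \<Rightarrow> real \<Rightarrow> real \<Rightarrow> ('a \<Rightarrow> real) \<Rightarrow> ('a \<Rightarrow> real) \<Rightarrow> bool" where
  "coexisting_solution \<Omega> \<nu> d1 d2 a11 a22 a1 a2 \<alpha>1 \<alpha>2 \<beta>1 \<beta>2 u v \<longleftrightarrow>
     nonneg_classical_solution \<Omega> \<nu> d1 d2 a11 a22 a1 a2 \<alpha>1 \<alpha>2 \<beta>1 \<beta>2 u v \<and>
     (\<exists>x\<in>closure \<Omega>. u x \<noteq> 0) \<and> (\<exists>x\<in>closure \<Omega>. v x \<noteq> 0)"

end

theory Submission
  imports Defs
begin

text \<open>Both alternatives are exchanged by swapping \<open>u\<close> and \<open>v\<close>, so consider the first one and suppose
  \<open>u\<close> and \<open>v\<close> do not vanish identically. Write \<open>f = 1 - u - a1 v\<close>, \<open>g = 1 - a2 u - v\<close>,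
  \<open>U = (d1 + a11 u) u\<close>, \<open>V = (d2 + a22 v) v\<close>, so that \<open>\<nabla>U = D1 \<nabla>u\<close> and \<open>\<nabla>V = D2 \<nabla>v\<close> with
  \<open>D1 = d1 + 2 a11 u\<close>, \<open>D2 = d2 + 2 a22 v\<close>. The maximum principle gives \<open>v \<le> 1\<close>, hence
  \<open>D2 \<le> d2 + 2 a22 \<le> d1 \<le> D1\<close>, and the strong maximum principle gives \<open>v > 0\<close> in \<open>\<Omega>\<close>. For the
  field \<open>X = u \<nabla>U - (u\<^sup>2 / (v + \<epsilon>)) \<nabla>V\<close>, Picone's inequality yields
  \<open>div X \<ge> u\<^sup>2 (g v / (v + \<epsilon>) - f)\<close>, while the Robin conditions with \<open>\<alpha>1 / \<beta>1 \<ge> 1 \<ge> \<alpha>2 / \<beta>2\<close> make the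
  outward flux \<open>X \<bullet> \<nu>\<close> nonpositive. Integrating and letting \<open>\<epsilon>\<close> tend to 0 gives
  \<open>\<integral> u\<^sup>2 (g - f) \<le> 0\<close>, although \<open>g - f = (1 - a2) u + (a1 - 1) v > 0\<close>.

  Only an inequality form of the divergence theorem is needed. It follows from the fact that
  \<open>div (\<eta> X)\<close> has integral zero for compactly supported \<open>\<eta>\<close>, taken for \<open>\<eta>\<close> a function of a global
  defining function of \<open>\<Omega>\<close>; no surface measure enters.\<close>

section \<open>Divergence theorem, inequality form\<close>

text \<open>Directional derivatives are recorded at parameter 0 of a line; re-centring the line at
  another of its points yields the derivative at every parameter, as the mean value theorem
  needs.\<close>

lemma has_real_derivative_line_shift:
  fixes x e :: "'a::real_normed_vector"
  assumes "((\<lambda>t. f (x + s *\<^sub>R e + t *\<^sub>R e)) has_real_derivative D) (at 0)"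
  shows "((\<lambda>t. f (x + t *\<^sub>R e)) has_real_derivative D) (at s)"
proof -
  have "((\<lambda>t. f (x + s *\<^sub>R e + (t - s) *\<^sub>R e)) has_real_derivative D * 1) (at s)"
    by (rule DERIV_chain'[where g = "\<lambda>t. f (x + s *\<^sub>R e + t *\<^sub>R e)" and f = "\<lambda>t. t - s"])
       (use assms in \<open>auto intro!: derivative_eq_intros\<close>)
  moreover have "x + s *\<^sub>R e + (t - s) *\<^sub>R e = x + t *\<^sub>R e" for t by (simp add: algebra_simps)
  ultimately show ?thesis by simp
qed

text \<open>Translation invariance of Lebesgue measure gives every difference quotient of
  \<open>h\<close> integral zero, and dominated convergence passes this on to \<open>h'\<close>.
  Differentiability along \<open>e\<close> suffices for a divergence, where each component is
  differentiated in its own direction only.\<close>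

lemma integral_compact_support_directional_deriv:
  fixes h h' :: "'a::euclidean_space \<Rightarrow> real"
  assumes der: "\<And>x. ((\<lambda>t. h (x + t *\<^sub>R e)) has_real_derivative h' x) (at 0)"
    and cont: "continuous_on UNIV h" "continuous_on UNIV h'"
    and supp: "\<And>x. norm x > R \<Longrightarrow> h x = 0"
  shows "integrable lborel h'" and "integral\<^sup>L lborel h' = 0"
proof -
  \<comment> \<open>Outside the closed ball \<open>h\<close> vanishes near each point, so
    \<open>h'\<close> vanishes too and is bounded by its bound on a compact ball.\<close>
  have supp': "h' x = 0" if "norm x > R" for x
  proof -
    have "((\<lambda>t. norm (x + t *\<^sub>R e)) \<longlongrightarrow> norm (x + 0 *\<^sub>R e)) (at 0)"
      by (intro tendsto_intros)
    hence "\<forall>\<^sub>F t in at 0. norm (x + t *\<^sub>R e) > R"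
      using that by (intro order_tendstoD) auto
    hence "\<forall>\<^sub>F t in at 0. (h (x + t *\<^sub>R e) - h (x + 0 *\<^sub>R e)) / (t - 0) = 0"
      by eventually_elim (use that supp in auto)
    moreover have "((\<lambda>t. (h (x + t *\<^sub>R e) - h (x + 0 *\<^sub>R e)) / (t - 0)) \<longlongrightarrow> h' x) (at 0)"
      using der[of x] by (simp add: has_field_derivative_iff)
    ultimately have "((\<lambda>t::real. 0) \<longlongrightarrow> h' x) (at 0)"
      using Lim_transform_eventually by fastforce
    thus ?thesis by (simp add: tendsto_const_iff)
  qed
  have "compact (h' ` cball 0 R)"
    by (intro compact_continuous_image continuous_on_subset[OF cont(2)]) auto
  then obtain M where M: "\<And>x. x \<in> cball 0 R \<Longrightarrow> \<bar>h' x\<bar> \<le> M"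
    by (metis compact_imp_bounded bounded_iff image_eqI real_norm_def)
  have M': "\<bar>h' x\<bar> \<le> \<bar>M\<bar>" for x
    using M[of x] supp'[of x] by (cases "norm x > R") auto
  have der_line: "((\<lambda>t. h (x + t *\<^sub>R e)) has_real_derivative h' (x + s *\<^sub>R e)) (at s)" for x s
    by (rule has_real_derivative_line_shift[OF der])
  define \<tau> where "\<tau> n = inverse (real (Suc n))" for n
  define s where "s n x = (h (x + \<tau> n *\<^sub>R e) - h x) / \<tau> n" for n x
  \<comment> \<open>The steps \<open>\<tau> n\<close> are at most 1, so the shifted point moves by
    at most \<open>norm e\<close>; enlarging the radius by that amount makes \<open>w\<close>
    dominate all quotients.\<close>
  define w where "w x = \<bar>M\<bar> * indicator (cball (0::'a) (R + norm e)) x" for x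
  have \<tau>: "0 < \<tau> n" "\<tau> n \<le> 1" for n by (auto simp: \<tau>_def divide_simps)
  have int_w: "integrable lborel w" unfolding w_def
    by (intro integrable_mult_right integrable_real_indicator) (use emeasure_lborel_cball_finite in \<open>auto simp: infinity_ennreal_def\<close>)
  have hb[measurable]: "h \<in> borel_measurable borel" "h' \<in> borel_measurable borel"
    using cont borel_measurable_continuous_onI by blast+
  have hm: "h' \<in> borel_measurable lborel" by measurable
  have smeas: "s n \<in> borel_measurable lborel" for n
    unfolding s_def by measurable
  have lim: "(\<lambda>n. s n x) \<longlonglongrightarrow> h' x" for x
  proof -
    have "((\<lambda>t. (h (x + t *\<^sub>R e) - h x) / t) \<longlongrightarrow> h' x) (at 0)"
      using der[of x] by (simp add: has_field_derivative_iff)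
    moreover have "filterlim \<tau> (at 0) sequentially"
      unfolding filterlim_at using \<tau> LIMSEQ_inverse_real_of_nat
      by (auto simp: \<tau>_def[abs_def])
    ultimately show ?thesis unfolding s_def by (rule filterlim_compose)
  qed
  have bound: "norm (s n x) \<le> w x" for n x
  proof (cases "norm x \<le> R + norm e")
    case True
    obtain z where "h (x + \<tau> n *\<^sub>R e) - h (x + 0 *\<^sub>R e) = (\<tau> n - 0) * h' (x + z *\<^sub>R e)"
      using MVT2[OF \<tau>(1)[of n], of "\<lambda>t. h (x + t *\<^sub>R e)" "\<lambda>t. h' (x + t *\<^sub>R e)"] der_line by auto
    hence "s n x = h' (x + z *\<^sub>R e)" using \<tau>(1)[of n] by (simp add: s_def)
    thus ?thesis using M' True by (simp add: w_def)
  next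
    case False
    have "norm x \<le> norm (x + \<tau> n *\<^sub>R e) + norm (\<tau> n *\<^sub>R e)"
      by (metis add_diff_cancel_right' norm_triangle_ineq4)
    moreover have "norm (\<tau> n *\<^sub>R e) \<le> norm e"
      using \<tau>[of n] by (simp add: mult_left_le_one_le)
    ultimately have "norm (x + \<tau> n *\<^sub>R e) > R" "norm x > R"
      using False by (auto simp del: norm_scaleR) (smt (verit) norm_ge_zero)
    thus ?thesis by (simp add: s_def w_def supp)
  qed
  have 1: "integrable lborel h'" "\<And>n. integrable lborel (s n)"
    "(\<lambda>n. integral\<^sup>L lborel (s n)) \<longlonglongrightarrow> integral\<^sup>L lborel h'"
    using integrable_dominated_convergence[where s = s, OF hm smeas int_w AE_I2 AE_I2, OF lim bound]
      integrable_dominated_convergence2[where s = s, OF hm smeas int_w AE_I2 AE_I2, OF lim bound]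
      integral_dominated_convergence[where s = s, OF hm smeas int_w AE_I2 AE_I2, OF lim bound] by auto
  have int_h: "integrable lborel h"
  proof -
    have "integrable lborel (\<lambda>x. indicator (cball 0 R) x *\<^sub>R h x)"
      by (intro borel_integrable_compact continuous_on_subset[OF cont(1)]) auto
    moreover have "(\<lambda>x. indicator (cball 0 R) x *\<^sub>R h x) = h"
      using supp by (auto simp: fun_eq_iff indicator_def)
    ultimately show ?thesis by simp
  qed
  have "integral\<^sup>L lborel (s n) = 0" for n
  proof -
    have i: "integrable lborel (\<lambda>x. h (\<tau> n *\<^sub>R e + x))"
      using int_h integrable_distr[of "(+) (\<tau> n *\<^sub>R e)" lborel borel h]
      by (simp add: lborel_distr_plus)
    have "integral\<^sup>L lborel (\<lambda>x. h (\<tau> n *\<^sub>R e + x)) = integral\<^sup>L (distr lborel borel ((+) (\<tau> n *\<^sub>R e))) h"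
      by (subst integral_distr) auto
    hence "integral\<^sup>L lborel (\<lambda>x. h (\<tau> n *\<^sub>R e + x)) = integral\<^sup>L lborel h"
      by (simp add: lborel_distr_plus)
    thus ?thesis using int_h i
      by (simp add: s_def[abs_def] add.commute Bochner_Integration.integral_diff)
  qed
  hence "integral\<^sup>L lborel h' = 0"
    using 1(3) LIMSEQ_unique tendsto_const by (metis (no_types, lifting) LIMSEQ_const_iff LIMSEQ_unique ext)
  thus "integrable lborel h'" "integral\<^sup>L lborel h' = 0" using 1 by auto
qed

section \<open>Gradients and the outward unit normal\<close>

lemma grad_has_derivative:
  assumes "f differentiable (at x)"
  shows "(f has_derivative (\<lambda>h. grad f x \<bullet> h)) (at x)"
proof -
  have d: "(f has_derivative frechet_derivative f (at x)) (at x)"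
    using assms frechet_derivative_works by blast
  have "frechet_derivative f (at x) h = grad f x \<bullet> h" for h
  proof -
    interpret linear "frechet_derivative f (at x)"
      using d has_derivative_linear by blast
    have "frechet_derivative f (at x) h = frechet_derivative f (at x) (\<Sum>e\<in>Basis. (h \<bullet> e) *\<^sub>R e)"
      by (simp add: euclidean_representation)
    also have "\<dots> = (\<Sum>e\<in>Basis. (h \<bullet> e) * frechet_derivative f (at x) e)"
      by (simp add: sum scaleR)
    also have "\<dots> = grad f x \<bullet> h"
      by (simp add: grad_def partial_deriv_def inner_sum_left inner_commute[of h] mult.commute)
    finally show ?thesis .
  qed
  hence "frechet_derivative f (at x) = (\<lambda>h. grad f x \<bullet> h)" by auto
  thus ?thesis using d by simp
qed

lemma grad_inner_Basis: "e \<in> Basis \<Longrightarrow> grad f x \<bullet> e = partial_deriv e f x"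
  by (simp add: grad_def inner_sum_left inner_Basis if_distrib cong: if_cong)

lemma directional_derivative_sign:
  assumes der: "(f has_derivative (\<lambda>h. g \<bullet> h)) (at x)" and w: "g \<bullet> w < (0::real)"
  shows "\<forall>\<^sub>F t in at_right 0. f (x + t *\<^sub>R w) < f x"
proof -
  have "((\<lambda>t. f (x + t *\<^sub>R w)) has_derivative (\<lambda>t. g \<bullet> (t *\<^sub>R w))) (at 0)"
    by (rule has_derivative_compose[where f = "\<lambda>t. x + t *\<^sub>R w" and g = f])
       (auto intro!: derivative_eq_intros der)
  hence "((\<lambda>t. f (x + t *\<^sub>R w)) has_real_derivative g \<bullet> w) (at 0)"
    by (simp add: has_field_derivative_def mult.commute[of _ "g \<bullet> w"])
  then obtain d where "d > 0" "\<And>h. h > 0 \<Longrightarrow> h < d \<Longrightarrow> f (x + (0 + h) *\<^sub>R w) < f (x + 0 *\<^sub>R w)"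
    using DERIV_neg_dec_right[of "\<lambda>t. f (x + t *\<^sub>R w)" "g \<bullet> w" 0] w by blast
  thus ?thesis unfolding eventually_at_right_field by (intro exI[of _ d]) auto
qed

lemma smooth_on_grad:
  assumes "smooth_on f U" "open U"
  shows "\<And>x. x \<in> U \<Longrightarrow> (f has_derivative (\<lambda>h. grad f x \<bullet> h)) (at x)"
    and "continuous_on U (grad f)"
proof -
  have 1: "Ck_on 1 f U" using assms(1) by (auto simp: smooth_on_def)
  hence "f differentiable_on U" by simp
  thus "\<And>x. x \<in> U \<Longrightarrow> (f has_derivative (\<lambda>h. grad f x \<bullet> h)) (at x)"
    using assms(2) by (simp add: grad_has_derivative differentiable_on_eq_differentiable_at)
  show "continuous_on U (grad f)"
    unfolding grad_def[abs_def] using 1 by (auto intro!: continuous_intros)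
qed

lemma local_defining_function_inward:
  assumes "local_defining_function S p U \<phi>" "q \<in> frontier S \<inter> U" "grad \<phi> q \<bullet> w < 0"
  shows "\<forall>\<^sub>F t in at_right 0. q + t *\<^sub>R w \<in> S"
proof -
  have *: "open U" "smooth_on \<phi> U" "S \<inter> U = {x\<in>U. \<phi> x < 0}" "\<phi> q = 0" "q \<in> U"
    using assms(1,2) by (auto simp: local_defining_function_def)
  have "\<forall>\<^sub>F t in at_right 0. \<phi> (q + t *\<^sub>R w) < \<phi> q"
    using * assms(3) by (intro directional_derivative_sign[OF smooth_on_grad(1)])
  moreover have "((\<lambda>t. q + t *\<^sub>R w) \<longlongrightarrow> q + 0 *\<^sub>R w) (at_right 0)"
    by (intro tendsto_intros)
  hence "\<forall>\<^sub>F t in at_right 0. q + t *\<^sub>R w \<in> U"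
    by (rule topological_tendstoD) (use * in auto)
  ultimately show ?thesis by eventually_elim (use * in auto)
qed

text \<open>The gradient of a defining function fixes the inward directions: if its product with
  \<open>w\<close> is negative, the ray along \<open>w\<close> enters \<open>S\<close>. Two defining
  functions thus share a half-space, which makes their gradients positively proportional and the
  normal independent of the chart.\<close>

lemma local_defining_function_sgn_grad_unique:
  assumes \<phi>: "local_defining_function S p U \<phi>" "q \<in> frontier S \<inter> U"
    and \<psi>: "local_defining_function S p' U' \<psi>" "q \<in> frontier S \<inter> U'"
  shows "sgn (grad \<phi> q) = sgn (grad \<psi> q)"
proof -
  define a b where "a = grad \<phi> q" and "b = grad \<psi> q"
  have nz: "a \<noteq> 0" "b \<noteq> 0"
    using assms by (auto simp: local_defining_function_def a_def b_def)
  \<comment> \<open>If \<open>b \<bullet> w\<close> were positive, \<open>\<psi>\<close> would be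
    positive along the start of the ray and put it outside \<open>S\<close>, whereas
    \<open>a \<bullet> w < 0\<close> puts it inside.\<close>
  have half: "b \<bullet> w \<le> 0" if "a \<bullet> w < 0" for w
  proof (rule ccontr)
    assume "\<not> b \<bullet> w \<le> 0"
    hence w: "grad \<psi> q \<bullet> w > 0" by (simp add: b_def)
    have *: "open U'" "smooth_on \<psi> U'" "S \<inter> U' = {x\<in>U'. \<psi> x < 0}" "\<psi> q = 0" "q \<in> U'"
      using \<psi> by (auto simp: local_defining_function_def)
    have "((\<lambda>x. - \<psi> x) has_derivative (\<lambda>h. (- grad \<psi> q) \<bullet> h)) (at q)"
      using smooth_on_grad(1)[OF *(2,1,5)] by (auto intro!: derivative_eq_intros)
    hence "\<forall>\<^sub>F t in at_right 0. - \<psi> (q + t *\<^sub>R w) < - \<psi> q"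
      by (rule directional_derivative_sign) (use w in auto)
    moreover have "\<forall>\<^sub>F t in at_right 0. q + t *\<^sub>R w \<in> S"
      using local_defining_function_inward[OF \<phi>] that by (simp add: a_def)
    moreover have "((\<lambda>t. q + t *\<^sub>R w) \<longlongrightarrow> q + 0 *\<^sub>R w) (at_right 0)"
      by (intro tendsto_intros)
    hence "\<forall>\<^sub>F t in at_right 0. q + t *\<^sub>R w \<in> U'"
      by (rule topological_tendstoD) (use * in auto)
    ultimately have "\<forall>\<^sub>F t::real in at_right 0. False"
    proof eventually_elim
      case (elim t)
      hence "q + t *\<^sub>R w \<in> S \<inter> U'" by blast
      thus False using elim * by auto
    qed
    thus False by simp
  qed
  have "a \<bullet> b \<ge> 0" using half[of "- a"] nz by (simp add: inner_commute)
  moreover have "(norm a)\<^sup>2 * (norm b)\<^sup>2 \<le> (a \<bullet> b)\<^sup>2"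
  proof -
    \<comment> \<open>\<open>z\<close> is the part of \<open>b\<close> orthogonal to
      \<open>a\<close>. Tilting it by \<open>- \<tau> *\<^sub>R a\<close> moves it into the open
      half-space, and \<open>\<tau>\<close> then tends to 0. The outcome
      \<open>b \<bullet> z \<le> 0\<close> is the reverse Cauchy-Schwarz inequality.\<close>
    define z where "z = b - ((a \<bullet> b) / (a \<bullet> a)) *\<^sub>R a"
    have az: "a \<bullet> z = 0" using nz by (simp add: z_def inner_diff_right)
    have "b \<bullet> z - \<tau> * (a \<bullet> b) \<le> 0" if "\<tau> > 0" for \<tau>
      using half[of "z - \<tau> *\<^sub>R a"] that nz az
      by (simp add: inner_diff_right inner_commute)
    hence "\<forall>\<^sub>F \<tau> in at_right 0. b \<bullet> z - \<tau> * (a \<bullet> b) \<le> 0"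
      by (auto simp: eventually_at_right_field intro: exI[of _ 1])
    moreover have "((\<lambda>\<tau>. b \<bullet> z - \<tau> * (a \<bullet> b)) \<longlongrightarrow> b \<bullet> z - 0 * (a \<bullet> b)) (at_right 0)"
      by (intro tendsto_intros)
    ultimately have "b \<bullet> z \<le> 0"
      using tendsto_upperbound[of _ "b \<bullet> z - 0 * (a \<bullet> b)" "at_right (0::real)" 0] by auto
    hence "(a \<bullet> a) * (b \<bullet> b) \<le> (a \<bullet> b) * (a \<bullet> b)"
      using nz by (simp add: z_def inner_diff_right inner_commute field_simps)
    thus ?thesis by (simp only: power2_norm_eq_inner power2_eq_square[of "a \<bullet> b"])
  qed
  ultimately have "norm a * norm b \<le> a \<bullet> b"
    by (metis abs_le_square_iff abs_of_nonneg norm_ge_zero power_mult_distrib mult_nonneg_nonneg)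
  hence "a \<bullet> b = norm a * norm b" using norm_cauchy_schwarz[of a b] by simp
  hence "norm a *\<^sub>R b = norm b *\<^sub>R a" by (simp add: norm_cauchy_schwarz_eq)
  hence "sgn a = sgn b"
    using nz by (simp add: sgn_div_norm) (metis (no_types, opaque_lifting) divideR_right norm_eq_zero scaleR_left_commute)
  thus ?thesis by (simp add: a_def b_def)
qed

text \<open>The definition supplies some defining function for each boundary point separately; by
  uniqueness of the direction, any chart containing \<open>q\<close> computes the same
  normal.\<close>

lemma outward_unit_normal_eq:
  assumes "outward_unit_normal S \<nu>" "local_defining_function S p U \<phi>" "q \<in> frontier S" "q \<in> U"
  shows "\<nu> q = sgn (grad \<phi> q)"
proof -
  obtain U' \<psi> where "local_defining_function S q U' \<psi>" "\<nu> q = sgn (grad \<psi> q)"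
    using assms(1,3) by (auto simp: outward_unit_normal_def)
  moreover from this have "q \<in> U'" by (simp add: local_defining_function_def)
  ultimately show ?thesis
    using local_defining_function_sgn_grad_unique assms by (metis IntI)
qed

lemma outward_unit_normal_inward:
  assumes "outward_unit_normal S \<nu>" "q \<in> frontier S"
  shows "\<forall>\<^sub>F t in at_right 0. q - t *\<^sub>R \<nu> q \<in> S"
proof -
  obtain U \<phi> where *: "local_defining_function S q U \<phi>" "\<nu> q = sgn (grad \<phi> q)"
    using assms by (auto simp: outward_unit_normal_def)
  hence q: "q \<in> U" "grad \<phi> q \<noteq> 0" by (auto simp: local_defining_function_def)
  have "grad \<phi> q \<bullet> (- \<nu> q) < 0"
    using q by (simp add: * sgn_div_norm dot_square_norm power2_eq_square)
  thus ?thesis using local_defining_function_inward[OF *(1), of q "- \<nu> q"] q assms by simp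
qed

section \<open>Bump functions and a global defining function\<close>

text \<open>Squaring removes the corner at 0, so the function is C^1 everywhere. Both
  \<open>bump\<close> and \<open>cutoff\<close> are built from it.\<close>

lemma pos_part_square_has_real_derivative:
  "((\<lambda>t::real. (max 0 t)\<^sup>2) has_real_derivative 2 * max 0 t) (at t)"
proof (cases t "0::real" rule: linorder_cases)
  case less
  have "((\<lambda>t::real. 0) has_real_derivative 2 * max 0 t) (at t)"
    using less by simp
  thus ?thesis
    by (rule has_field_derivative_transform_within_open[of _ _ _ "{..<0}"]) (use less in auto)
next
  case equal
  have "((\<lambda>h. (max 0 h)\<^sup>2 / h) \<longlongrightarrow> (0::real)) (at 0)"
  proof (rule Lim_null_comparison[where g = "\<lambda>h. \<bar>h\<bar>"])
    show "\<forall>\<^sub>F h in at 0. norm ((max 0 h)\<^sup>2 / h) \<le> \<bar>h::real\<bar>"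
      by (intro always_eventually) (auto simp: max_def power2_eq_square)
    show "((\<lambda>h::real. \<bar>h\<bar>) \<longlongrightarrow> 0) (at 0)"
      by (intro tendsto_rabs_zero tendsto_ident_at)
  qed
  thus ?thesis using equal by (simp add: has_field_derivative_iff)
next
  case greater
  have "((\<lambda>t::real. t\<^sup>2) has_real_derivative 2 * max 0 t) (at t)"
    using greater by (auto intro!: derivative_eq_intros)
  thus ?thesis
    by (rule has_field_derivative_transform_within_open[of _ _ _ "{0<..}"]) (use greater in auto)
qed

text \<open>For \<open>r > 0\<close> this is a C^1 function that is positive exactly on
  \<open>ball p r\<close>.\<close>

definition bump :: "'a::euclidean_space \<Rightarrow> real \<Rightarrow> 'a \<Rightarrow> real" where
  "bump p r x = (max 0 (r\<^sup>2 - (x - p) \<bullet> (x - p)))\<^sup>2"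

definition bump_grad :: "'a::euclidean_space \<Rightarrow> real \<Rightarrow> 'a \<Rightarrow> 'a" where
  "bump_grad p r x = (- 4 * max 0 (r\<^sup>2 - (x - p) \<bullet> (x - p))) *\<^sub>R (x - p)"

lemma bump_has_derivative: "(bump p r has_derivative (\<lambda>h. bump_grad p r x \<bullet> h)) (at x)"
proof -
  have "((\<lambda>x. r\<^sup>2 - (x - p) \<bullet> (x - p)) has_derivative (\<lambda>h. - 2 * ((x - p) \<bullet> h))) (at x)"
    by (auto intro!: derivative_eq_intros simp: inner_commute)
  from has_derivative_compose[OF this
      pos_part_square_has_real_derivative[unfolded has_field_derivative_def]]
  show ?thesis unfolding bump_def[abs_def] bump_grad_def by (simp add: mult_ac)
qed

lemma continuous_on_bump: "continuous_on A (bump p r)" "continuous_on A (bump_grad p r)"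
  unfolding bump_def[abs_def] bump_grad_def[abs_def] by (intro continuous_intros)+

lemma bump_nonneg: "bump p r x \<ge> 0" by (simp add: bump_def)

lemma bump_pos:
  assumes "x \<in> ball p r" shows "bump p r x > 0"
proof -
  have "norm (x - p) < r" using assms by (simp add: dist_norm norm_minus_commute)
  hence "(x - p) \<bullet> (x - p) < r\<^sup>2"
    by (metis norm_ge_zero power2_norm_eq_inner power_strict_mono zero_less_numeral)
  thus ?thesis by (simp add: bump_def)
qed

lemma bump_outside:
  assumes "x \<notin> ball p r" "0 < r" shows "bump p r x = 0" "bump_grad p r x = 0"
proof -
  have "norm (x - p) \<ge> r" using assms by (simp add: dist_norm norm_minus_commute)
  hence "(x - p) \<bullet> (x - p) \<ge> r\<^sup>2"
    using assms by (metis less_eq_real_def power2_norm_eq_inner power_mono)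
  thus "bump p r x = 0" "bump_grad p r x = 0" by (simp_all add: bump_def bump_grad_def)
qed

text \<open>\<open>\<psi>\<close> carries no information outside \<open>U\<close>, yet the product
  is C^1 on the whole space: \<open>U\<close> and the complement of \<open>cball p r\<close> are
  open and cover everything, and on the latter \<open>bump\<close> and \<open>bump_grad\<close>
  vanish.\<close>

lemma bump_mult:
  fixes \<psi> :: "'a::euclidean_space \<Rightarrow> real"
  assumes "open U" "cball p r \<subseteq> U" "0 < r"
    and der: "\<And>x. x \<in> U \<Longrightarrow> (\<psi> has_derivative (\<lambda>h. g x \<bullet> h)) (at x)"
    and cont: "continuous_on U g"
  defines "G \<equiv> \<lambda>x. bump p r x *\<^sub>R g x + \<psi> x *\<^sub>R bump_grad p r x"
  shows "((\<lambda>x. bump p r x * \<psi> x) has_derivative (\<lambda>h. G x \<bullet> h)) (at x)"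
    and "continuous_on UNIV G"
proof -
  have out: "bump p r x = 0" "bump_grad p r x = 0" if "x \<in> - cball p r" for x
    using that bump_outside[of x p r] assms(3) by auto
  have UN: "U \<union> - cball p r = UNIV" using assms(2) by auto
  show "((\<lambda>x. bump p r x * \<psi> x) has_derivative (\<lambda>h. G x \<bullet> h)) (at x)"
  proof (cases "x \<in> U")
    case True
    show ?thesis unfolding G_def
      by (auto intro!: derivative_eq_intros bump_has_derivative der[OF True] simp: inner_add_left)
  next
    case False
    hence x: "x \<in> - cball p r" using assms(2) by auto
    have "((\<lambda>x. 0) has_derivative (\<lambda>h. G x \<bullet> h)) (at x)"
      using out[OF x] by (simp add: G_def)
    thus ?thesis
      by (rule has_derivative_transform_within_open[of _ _ _ _ "- cball p r"]) (use x out in auto)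
  qed
  have "continuous_on U \<psi>"
    using der by (meson differentiable_at_imp_differentiable_on differentiable_def
        differentiable_imp_continuous_on)
  hence "continuous_on U G" unfolding G_def
    by (intro continuous_intros cont continuous_on_bump)
  moreover have "continuous_on (- cball p r) G"
    by (subst continuous_on_cong[OF refl, of _ _ "\<lambda>x. 0"]) (auto simp: G_def out)
  ultimately show "continuous_on UNIV G"
    using continuous_on_open_Un[OF \<open>open U\<close>, of "- cball p r" G] UN by auto
qed

text \<open>For points of the domain the data are trivial (\<open>\<psi> = 1\<close>, \<open>w = 0\<close>) on a ball that avoids
  the boundary; this lets one compactness argument produce a defining function positive on the
  whole domain.\<close>
lemma local_defining_data:
  fixes \<Omega> :: "'a::euclidean_space set"
  assumes "open \<Omega>" "smooth_boundary \<Omega>" "outward_unit_normal \<Omega> \<nu>" "p \<in> closure \<Omega>"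
  shows "\<exists>U r \<psi> g w. open U \<and> cball p r \<subseteq> U \<and> 0 < r \<and>
     (\<forall>x\<in>U. (\<psi> has_derivative (\<lambda>h. g x \<bullet> h)) (at x)) \<and> continuous_on U g \<and>
     (\<forall>x\<in>U \<inter> \<Omega>. \<psi> x > 0) \<and>
     (\<forall>q\<in>U \<inter> frontier \<Omega>. \<psi> q = (0::real) \<and> w \<bullet> \<nu> q > 0 \<and> (\<exists>s>0. g q = (- s) *\<^sub>R \<nu> q))"
proof (cases "p \<in> \<Omega>")
  case True
  obtain r where "r > 0" "cball p r \<subseteq> \<Omega>"
    using True assms(1) open_contains_cball by blast
  moreover have "\<Omega> \<inter> frontier \<Omega> = {}"
    using assms(1) frontier_disjoint_eq[of \<Omega>] by blast
  ultimately show ?thesis using assms(1)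
    by (intro exI[of _ \<Omega>] exI[of _ r] exI[of _ "\<lambda>x. 1"] exI[of _ "\<lambda>x. 0"] exI[of _ 0]) auto
next
  case False
  hence p: "p \<in> frontier \<Omega>" using assms by (simp add: frontier_def interior_open)
  obtain U \<phi> where L: "local_defining_function \<Omega> p U \<phi>"
    using assms(2) p by (auto simp: smooth_boundary_def)
  hence L': "open U" "p \<in> U" "smooth_on \<phi> U" "\<And>x. x \<in> U \<Longrightarrow> grad \<phi> x \<noteq> 0"
    "\<Omega> \<inter> U = {x\<in>U. \<phi> x < 0}" "frontier \<Omega> \<inter> U = {x\<in>U. \<phi> x = 0}"
    by (auto simp: local_defining_function_def)
  note der = smooth_on_grad[OF L'(3,1)]
  \<comment> \<open>With \<open>w\<close> frozen at the gradient in \<open>p\<close>, shrinking the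
    chart to \<open>U'\<close> keeps all gradients at an acute angle to it, so one constant vector
    points outward along this piece of boundary. The sign of \<open>\<phi>\<close> is flipped below
    to be positive inside.\<close>
  define w where "w = grad \<phi> p"
  define U' where "U' = {x\<in>U. w \<bullet> grad \<phi> x \<in> {0<..}}"
  have "open U'" unfolding U'_def vimage_def[symmetric]
    using continuous_open_preimage[OF continuous_on_inner[OF continuous_on_const der(2)] L'(1) open_greaterThan, of w 0]
    by (simp add: vimage_def Int_def)
  moreover have "p \<in> U'" using L' by (auto simp: U'_def w_def)
  ultimately obtain r where r: "r > 0" "cball p r \<subseteq> U'" using open_contains_cball by blast
  have sub: "U' \<subseteq> U" by (auto simp: U'_def)
  have nu: "\<nu> q = sgn (grad \<phi> q)" if "q \<in> U" "q \<in> frontier \<Omega>" for q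
    using outward_unit_normal_eq[OF assms(3) L] that by auto
  have "\<forall>q\<in>U' \<inter> frontier \<Omega>. - \<phi> q = 0 \<and> w \<bullet> \<nu> q > 0 \<and> (\<exists>s>0. - grad \<phi> q = (- s) *\<^sub>R \<nu> q)"
  proof (intro ballI conjI)
    fix q assume q: "q \<in> U' \<inter> frontier \<Omega>"
    hence qU: "q \<in> U" "q \<in> frontier \<Omega>" using sub by auto
    show "- \<phi> q = 0" using qU L'(6) by auto
    show "w \<bullet> \<nu> q > 0" using q L'(4)[OF qU(1)] by (simp add: nu[OF qU] sgn_div_norm U'_def)
    show "\<exists>s>0. - grad \<phi> q = (- s) *\<^sub>R \<nu> q"
      using L'(4)[OF qU(1)] by (intro exI[of _ "norm (grad \<phi> q)"]) (simp add: nu[OF qU] sgn_div_norm)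
  qed
  moreover have "\<forall>x\<in>U'. ((\<lambda>x. - \<phi> x) has_derivative (\<lambda>h. (- grad \<phi> x) \<bullet> h)) (at x)"
    using der(1) sub by (auto intro!: derivative_eq_intros)
  moreover have "continuous_on U' (\<lambda>x. - grad \<phi> x)"
    using der(2) sub by (intro continuous_intros) (auto intro: continuous_on_subset)
  moreover have "\<forall>x\<in>U' \<inter> \<Omega>. - \<phi> x > 0" using sub L'(5) by auto
  ultimately show ?thesis using \<open>open U'\<close> r
    by (intro exI[of _ U'] exI[of _ r] exI[of _ "\<lambda>x. - \<phi> x"] exI[of _ "\<lambda>x. - grad \<phi> x"] exI[of _ w]) blast
qed

text \<open>Finitely many balls with local data cover the compact closure and are glued with bumps
  as weights. The weights need not sum to 1: all conclusions concern signs and directions, which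
  survive sums with nonnegative weights, one of them positive at each point.\<close>

lemma global_defining_data:
  fixes \<Omega> :: "'a::euclidean_space set"
  assumes "open \<Omega>" "bounded \<Omega>" "smooth_boundary \<Omega>" "outward_unit_normal \<Omega> \<nu>"
  obtains \<rho> R and Z :: "'a \<Rightarrow> 'a" and DZ where
    "\<And>x. (\<rho> has_derivative (\<lambda>h. R x \<bullet> h)) (at x)" "continuous_on UNIV R"
    "\<And>x. x \<in> \<Omega> \<Longrightarrow> \<rho> x > 0" "\<And>q. q \<in> frontier \<Omega> \<Longrightarrow> \<rho> q = (0::real)"
    "\<And>q. q \<in> frontier \<Omega> \<Longrightarrow> \<exists>s>0. R q = (- s) *\<^sub>R \<nu> q"
    "\<And>x. (Z has_derivative DZ x) (at x)" "\<And>h. continuous_on UNIV (\<lambda>x. DZ x h)"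
    "\<And>q. q \<in> frontier \<Omega> \<Longrightarrow> Z q \<bullet> \<nu> q > 0"
proof -
  define D where "D p U r \<psi> g w \<longleftrightarrow> open U \<and> cball p r \<subseteq> U \<and> 0 < r \<and>
     (\<forall>x\<in>U. (\<psi> has_derivative (\<lambda>h. g x \<bullet> h)) (at x)) \<and> continuous_on U g \<and>
     (\<forall>x\<in>U \<inter> \<Omega>. \<psi> x > 0) \<and>
     (\<forall>q\<in>U \<inter> frontier \<Omega>. \<psi> q = (0::real) \<and> w \<bullet> \<nu> q > 0 \<and> (\<exists>s>0. g q = (- s) *\<^sub>R \<nu> q))"
    for p U r \<psi> w and g :: "'a \<Rightarrow> 'a"
  have "\<forall>p\<in>closure \<Omega>. \<exists>U r \<psi> g w. D p U r \<psi> g w"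
    using local_defining_data[OF assms(1,3,4)] unfolding D_def by blast
  then obtain U r \<psi> g w where D: "\<And>p. p \<in> closure \<Omega> \<Longrightarrow> D p (U p) (r p) (\<psi> p) (g p) (w p)"
    by metis
  have "compact (closure \<Omega>)" using assms(2) by (simp add: compact_closure)
  moreover have "closure \<Omega> \<subseteq> (\<Union>p\<in>closure \<Omega>. ball p (r p))"
    using D unfolding D_def by (auto intro!: bexI)
  ultimately obtain F where F: "F \<subseteq> closure \<Omega>" "finite F" "closure \<Omega> \<subseteq> (\<Union>p\<in>F. ball p (r p))"
    using compactE_image[of "closure \<Omega>" "closure \<Omega>" "\<lambda>p. ball p (r p)"] by (metis open_ball)
  have DF: "open (U p)" "cball p (r p) \<subseteq> U p" "0 < r p"
    "\<And>x. x \<in> U p \<Longrightarrow> (\<psi> p has_derivative (\<lambda>h. g p x \<bullet> h)) (at x)" "continuous_on (U p) (g p)"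
    "\<And>x. x \<in> U p \<inter> \<Omega> \<Longrightarrow> \<psi> p x > 0"
    "\<And>q. q \<in> U p \<inter> frontier \<Omega> \<Longrightarrow> \<psi> p q = (0::real) \<and> w p \<bullet> \<nu> q > 0 \<and> (\<exists>s>0. g p q = (- s) *\<^sub>R \<nu> q)"
    if "p \<in> F" for p using D[of p] F(1) that unfolding D_def by auto
  define b where "b p = bump p (r p)" for p
  define bg where "bg p = bump_grad p (r p)" for p
  define R where "R x = (\<Sum>p\<in>F. b p x *\<^sub>R g p x + \<psi> p x *\<^sub>R bg p x)" for x
  define \<rho> where "\<rho> x = (\<Sum>p\<in>F. b p x * \<psi> p x)" for x
  have b0: "b p x = 0" "bg p x = 0" if "p \<in> F" "x \<notin> U p" for p x
  proof -
    have "x \<notin> ball p (r p)" using DF(2)[OF that(1)] that(2) ball_subset_cball by blast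
    thus "b p x = 0" "bg p x = 0"
      using bump_outside[of x p "r p"] DF(3)[OF that(1)] by (simp_all add: b_def bg_def)
  qed
  have bnn: "b p x \<ge> 0" for p x by (simp add: b_def bump_nonneg)
  have cover: "\<exists>p\<in>F. b p x > 0 \<and> x \<in> U p" if x: "x \<in> closure \<Omega>" for x
  proof -
    obtain p where p: "p \<in> F" "x \<in> ball p (r p)" using F(3) x by blast
    moreover have "x \<in> U p" using p DF(2)[OF p(1)] ball_subset_cball by blast
    ultimately show ?thesis using bump_pos by (auto simp: b_def)
  qed
  have cf: "q \<in> closure \<Omega>" if "q \<in> frontier \<Omega>" for q using that by (simp add: frontier_def)
  note bm = bump_mult[OF DF(1,2,3,4,5)]
  show ?thesis
  proof
    show "(\<rho> has_derivative (\<lambda>h. R x \<bullet> h)) (at x)" for x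
      unfolding \<rho>_def[abs_def] R_def inner_sum_left b_def bg_def
      by (intro has_derivative_sum bm(1)) auto
    show "continuous_on UNIV R"
      unfolding R_def[abs_def] b_def bg_def by (intro continuous_on_sum bm(2)) auto
    show "\<rho> x > 0" if x: "x \<in> \<Omega>" for x
    proof -
      obtain p where p: "p \<in> F" "b p x > 0" "x \<in> U p"
        using cover x closure_subset by blast
      have "b p' x * \<psi> p' x \<ge> 0" if "p' \<in> F" for p'
        using bnn[of p' x] DF(6)[OF that, of x] b0[OF that, of x] x by (cases "x \<in> U p'") auto
      thus ?thesis unfolding \<rho>_def using p x DF(6)[OF p(1), of x] F(2)
        by (intro sum_pos2[of F p]) auto
    qed
    show "\<rho> q = 0" if q: "q \<in> frontier \<Omega>" for q
      unfolding \<rho>_def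
    proof (intro sum.neutral ballI)
      fix p assume "p \<in> F"
      thus "b p q * \<psi> p q = 0"
        using DF(7)[of p q] b0[of p q] q by (cases "q \<in> U p") auto
    qed
    show "\<exists>s>0. R q = (- s) *\<^sub>R \<nu> q" if q: "q \<in> frontier \<Omega>" for q
    proof -
      \<comment> \<open>At a boundary point of the chart \<open>\<psi> p\<close> is zero, so the
        derivative of the weight drops out and a nonpositive multiple of the normal is left. Outside
        the chart the weight is zero and the value of \<open>s\<close> is arbitrary.\<close>
      have "\<forall>p\<in>F. \<exists>s. s > 0 \<and> b p q *\<^sub>R g p q + \<psi> p q *\<^sub>R bg p q = (- (b p q * s)) *\<^sub>R \<nu> q"
      proof
        fix p assume p: "p \<in> F"
        show "\<exists>s. s > 0 \<and> b p q *\<^sub>R g p q + \<psi> p q *\<^sub>R bg p q = (- (b p q * s)) *\<^sub>R \<nu> q"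
        proof (cases "q \<in> U p")
          case True
          then obtain s where "s > 0" "g p q = (- s) *\<^sub>R \<nu> q" "\<psi> p q = 0"
            using DF(7)[OF p, of q] q by auto
          thus ?thesis by (intro exI[of _ s]) simp
        next
          case False
          thus ?thesis using b0[OF p, of q] by (intro exI[of _ 1]) simp
        qed
      qed
      then obtain s where s: "\<And>p. p \<in> F \<Longrightarrow> s p > 0 \<and>
          b p q *\<^sub>R g p q + \<psi> p q *\<^sub>R bg p q = (- (b p q * s p)) *\<^sub>R \<nu> q"
        by metis
      obtain p where p: "p \<in> F" "b p q > 0" using cover cf q by blast
      have "(\<Sum>p\<in>F. b p q * s p) > 0"
        using p s bnn F(2) by (intro sum_pos2[of F p]) (auto simp: less_imp_le)
      moreover have "R q = (- (\<Sum>p\<in>F. b p q * s p)) *\<^sub>R \<nu> q"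
        unfolding R_def using s by (simp add: scaleR_sum_left sum_negf)
      ultimately show ?thesis by blast
    qed
    show "((\<lambda>x. \<Sum>p\<in>F. b p x *\<^sub>R w p) has_derivative (\<lambda>h. \<Sum>p\<in>F. (bg p x \<bullet> h) *\<^sub>R w p)) (at x)" for x
      unfolding b_def bg_def
      by (intro has_derivative_sum has_derivative_scaleR_left bump_has_derivative)
    show "continuous_on UNIV (\<lambda>x. \<Sum>p\<in>F. (bg p x \<bullet> h) *\<^sub>R w p)" for h
      unfolding bg_def by (intro continuous_intros continuous_on_bump)
    show "(\<Sum>p\<in>F. b p q *\<^sub>R w p) \<bullet> \<nu> q > 0" if q: "q \<in> frontier \<Omega>" for q
    proof -
      obtain p where p: "p \<in> F" "b p q > 0" "q \<in> U p" using cover cf q by blast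
      have "b p' q * (w p' \<bullet> \<nu> q) \<ge> 0" if "p' \<in> F" for p'
        using DF(7)[OF that, of q] b0[OF that, of q] bnn[of p' q] q by (cases "q \<in> U p'") auto
      thus ?thesis unfolding inner_sum_left inner_scaleR_left
        using p F(2) DF(7)[OF p(1), of q] q by (intro sum_pos2[of F p]) auto
    qed
  qed
qed

section \<open>Boundary cutoff and vanishing integrals of divergences\<close>

text \<open>A nondecreasing C^1 step from 0 on \<open>s \<le> 1\<close> to 1 on
  \<open>s \<ge> 2\<close>: the inner square smooths the corner at 2, the outer one the corner at
  1.\<close>

definition cutoff :: "real \<Rightarrow> real" where
  "cutoff s = (max 0 (1 - (max 0 (2 - s))\<^sup>2))\<^sup>2"

definition cutoff' :: "real \<Rightarrow> real" where
  "cutoff' s = 4 * max 0 (1 - (max 0 (2 - s))\<^sup>2) * max 0 (2 - s)"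

lemma cutoff_has_real_derivative: "(cutoff has_real_derivative cutoff' s) (at s)"
proof -
  have "((\<lambda>s. (max 0 (2 - s))\<^sup>2) has_real_derivative 2 * max 0 (2 - s) * (-1)) (at s)"
    by (rule DERIV_chain'[where g = "\<lambda>t. (max 0 t)\<^sup>2", OF _ pos_part_square_has_real_derivative])
       (auto intro!: derivative_eq_intros)
  from DERIV_diff[OF DERIV_const[of 1] this] have "((\<lambda>s. 1 - (max 0 (2 - s))\<^sup>2) has_real_derivative 2 * max 0 (2 - s)) (at s)"
    by simp
  from DERIV_chain'[where g = "\<lambda>t. (max 0 t)\<^sup>2", OF this pos_part_square_has_real_derivative]
  show ?thesis unfolding cutoff_def[abs_def] cutoff'_def by (simp add: mult_ac)
qed

lemma continuous_on_cutoff: "continuous_on A cutoff" "continuous_on A cutoff'"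
  unfolding cutoff_def[abs_def] cutoff'_def[abs_def] by (intro continuous_intros)+

lemma cutoff_bounds: "0 \<le> cutoff s" "cutoff s \<le> 1" "0 \<le> cutoff' s"
  by (auto simp: cutoff_def cutoff'_def power_le_one)

lemma cutoff_le_1: assumes "s \<le> 1" shows "cutoff s = 0" "cutoff' s = 0"
proof -
  have "1 \<le> (max 0 (2 - s))\<^sup>2" using assms by (simp add: max_def)
  thus "cutoff s = 0" "cutoff' s = 0" by (simp_all add: cutoff_def cutoff'_def)
qed

lemma cutoff_ge_2: "s \<ge> 2 \<Longrightarrow> cutoff s = 1" "s \<ge> 2 \<Longrightarrow> cutoff' s = 0"
  by (simp_all add: cutoff_def cutoff'_def)

lemma has_derivative_along_line:
  assumes "(f has_derivative f') (at x)"
  shows "((\<lambda>t. f (x + t *\<^sub>R e)) has_derivative (\<lambda>t. t *\<^sub>R f' e)) (at 0)"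
proof -
  have "((\<lambda>t. f (x + t *\<^sub>R e)) has_derivative (\<lambda>t. f' (t *\<^sub>R e))) (at 0)"
    by (rule has_derivative_compose[where f = "\<lambda>t. x + t *\<^sub>R e" and g = f])
       (auto intro!: derivative_eq_intros assms)
  thus ?thesis using linear_scale[OF has_derivative_linear[OF assms]] by simp
qed

lemma has_real_derivative_along_line:
  fixes f :: "'a::real_normed_vector \<Rightarrow> real"
  assumes "(f has_derivative f') (at x)"
  shows "((\<lambda>t. f (x + t *\<^sub>R e)) has_real_derivative f' e) (at 0)"
  using has_derivative_along_line[OF assms, of e]
  by (simp add: has_field_derivative_def mult.commute[of _ "f' e"])

lemma eventually_along_line:
  fixes x e :: "'a::real_normed_vector"
  assumes "open S" "x \<in> S"
  shows "\<forall>\<^sub>F t in nhds 0. x + t *\<^sub>R e \<in> S"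
proof -
  have "((\<lambda>t. x + t *\<^sub>R e) \<longlongrightarrow> x + 0 *\<^sub>R e) (nhds 0)"
    by (intro tendsto_intros) (simp add: filterlim_def eventually_nhds_x_imp_x)
  thus ?thesis by (rule topological_tendstoD) (use assms in auto)
qed

text \<open>\<open>F\<close> is the divergence of the cutoff times \<open>Y\<close>, extended by
  zero. Since the cutoff vanishes near the boundary, the behaviour of \<open>Y\<close> there cannot
  enter, and each coordinate direction integrates to zero separately.\<close>

lemma integral_divergence_cutoff:
  fixes \<Omega> :: "'a::euclidean_space set" and Y :: "'a \<Rightarrow> 'a" and DY :: "'a \<Rightarrow> 'a \<Rightarrow> real"
  assumes \<Omega>: "open \<Omega>" "bounded \<Omega>"
    and \<rho>: "\<And>x. (\<rho> has_derivative (\<lambda>h. R x \<bullet> h)) (at x)" "continuous_on UNIV R"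
      "\<And>q. q \<in> frontier \<Omega> \<Longrightarrow> \<rho> q = (0::real)"
    and cY: "continuous_on \<Omega> Y"
    and dY: "\<And>e x. e \<in> Basis \<Longrightarrow> x \<in> \<Omega> \<Longrightarrow>
      ((\<lambda>t. Y (x + t *\<^sub>R e) \<bullet> e) has_real_derivative DY e x) (at 0)"
    and cDY: "\<And>e. e \<in> Basis \<Longrightarrow> continuous_on \<Omega> (DY e)"
    and \<delta>: "\<delta> > 0"
  defines "F \<equiv> \<lambda>x. indicator \<Omega> x * (cutoff' (\<rho> x / \<delta>) / \<delta> * (R x \<bullet> Y x)
      + cutoff (\<rho> x / \<delta>) * (\<Sum>e\<in>Basis. DY e x))"
  shows "integrable lborel F" "integral\<^sup>L lborel F = 0"
proof -
  define h where "h e x = (if x \<in> \<Omega> then cutoff (\<rho> x / \<delta>) * (Y x \<bullet> e) else 0)" for e x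
  define h' where "h' e x = (if x \<in> \<Omega> then cutoff' (\<rho> x / \<delta>) / \<delta> * (R x \<bullet> e) * (Y x \<bullet> e)
      + cutoff (\<rho> x / \<delta>) * DY e x else 0)" for e x
  have c\<rho>: "continuous_on A \<rho>" for A
    using \<rho>(1) by (meson continuous_at_imp_continuous_on has_derivative_continuous)
  have cR: "continuous_on A R" for A using \<rho>(2) continuous_on_subset by blast
  \<comment> \<open>Within \<open>\<Omega>\<close> the cutoff vanishes off \<open>C\<close>, and
    \<open>C\<close> avoids the boundary, where \<open>\<rho>\<close> is zero. So
    \<open>\<Omega>\<close> and \<open>- C\<close> are open sets covering the space; regularity is
    checked on each, the extension being zero on the second.\<close>
  define C where "C = {x\<in>closure \<Omega>. \<rho> x \<ge> \<delta>}"
  have "closed C" unfolding C_def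
    using continuous_closed_preimage[OF c\<rho> closed_closure, of "{\<delta>..}"]
    by (simp add: vimage_def Int_def)
  hence oC: "open (- C)" by auto
  have "C \<subseteq> \<Omega>"
  proof
    fix x assume x: "x \<in> C"
    hence "x \<notin> frontier \<Omega>" using \<rho>(3)[of x] \<delta> by (auto simp: C_def)
    thus "x \<in> \<Omega>" using x \<Omega>(1) by (auto simp: C_def frontier_def interior_open)
  qed
  hence UN: "\<Omega> \<union> - C = UNIV" by auto
  have outC: "h e x = 0" "h' e x = 0" if "x \<in> - C" for x e
  proof -
    have "\<rho> x / \<delta> \<le> 1" if "x \<in> \<Omega>"
      using \<open>x \<in> - C\<close> that closure_subset[of \<Omega>] \<delta> by (auto simp: C_def not_le)
    thus "h e x = 0" "h' e x = 0" by (auto simp: h_def h'_def cutoff_le_1)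
  qed
  obtain B where B: "\<And>x. x \<in> \<Omega> \<Longrightarrow> norm x \<le> B" using \<Omega>(2) bounded_iff by blast
  have hh: "integrable lborel (h' e) \<and> integral\<^sup>L lborel (h' e) = 0" if e: "e \<in> Basis" for e
  proof -
    have der: "((\<lambda>t. h e (x + t *\<^sub>R e)) has_real_derivative h' e x) (at 0)" for x
    proof (cases "x \<in> \<Omega>")
      case True
      have "((\<lambda>t. cutoff (\<rho> (x + t *\<^sub>R e) / \<delta>)) has_real_derivative
          cutoff' (\<rho> (x + 0 *\<^sub>R e) / \<delta>) * (R x \<bullet> e / \<delta>)) (at 0)"
        by (rule DERIV_chain'[where g = cutoff, OF _ cutoff_has_real_derivative])
           (intro DERIV_cdivide has_real_derivative_along_line \<rho>(1))
      from DERIV_mult[OF this dY[OF e True]]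
      have "((\<lambda>t. cutoff (\<rho> (x + t *\<^sub>R e) / \<delta>) * (Y (x + t *\<^sub>R e) \<bullet> e)) has_real_derivative h' e x) (at 0)"
        using True by (simp add: h'_def mult_ac)
      moreover have "\<forall>\<^sub>F t in nhds 0. cutoff (\<rho> (x + t *\<^sub>R e) / \<delta>) * (Y (x + t *\<^sub>R e) \<bullet> e) = h e (x + t *\<^sub>R e)"
        using eventually_along_line[OF \<Omega>(1) True, of e] by eventually_elim (simp add: h_def)
      ultimately show ?thesis by (subst (asm) DERIV_cong_ev) auto
    next
      case False
      hence x: "x \<in> - C" using UN by auto
      have "\<forall>\<^sub>F t in nhds 0. h e (x + t *\<^sub>R e) = 0"
        using eventually_along_line[OF oC x, of e] by eventually_elim (simp add: outC)
      thus ?thesis using DERIV_cong_ev[of 0 0 "\<lambda>t. h e (x + t *\<^sub>R e)" "\<lambda>t. 0" "h' e x" 0] outC[OF x]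
        by simp
    qed
    have comp: "continuous_on \<Omega> (\<lambda>x. cutoff (\<rho> x / \<delta>))" "continuous_on \<Omega> (\<lambda>x. cutoff' (\<rho> x / \<delta>))"
      using \<delta> by (auto intro!: continuous_on_compose2[OF continuous_on_cutoff(1)[of UNIV]]
          continuous_on_compose2[OF continuous_on_cutoff(2)[of UNIV]] continuous_intros c\<rho>)
    have "continuous_on \<Omega> (\<lambda>x. cutoff (\<rho> x / \<delta>) * (Y x \<bullet> e))"
      by (intro continuous_intros comp cY)
    hence 1: "continuous_on \<Omega> (h e)"
      by (subst continuous_on_cong[OF refl, of _ _ "\<lambda>x. cutoff (\<rho> x / \<delta>) * (Y x \<bullet> e)"]) (auto simp: h_def)
    have "continuous_on \<Omega> (\<lambda>x. cutoff' (\<rho> x / \<delta>) / \<delta> * (R x \<bullet> e) * (Y x \<bullet> e)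
      + cutoff (\<rho> x / \<delta>) * DY e x)"
      using \<delta> by (intro continuous_intros comp cY cR cDY[OF e]) auto
    hence 2: "continuous_on \<Omega> (h' e)"
      by (subst continuous_on_cong[OF refl, of _ _ "\<lambda>x. cutoff' (\<rho> x / \<delta>) / \<delta> * (R x \<bullet> e) * (Y x \<bullet> e)
      + cutoff (\<rho> x / \<delta>) * DY e x"]) (auto simp: h'_def)
    have 3: "continuous_on (- C) (h e)" "continuous_on (- C) (h' e)"
      by (subst continuous_on_cong[OF refl, of _ _ "\<lambda>x. 0"]; simp add: outC)+
    have "continuous_on UNIV (h e)" "continuous_on UNIV (h' e)"
      using continuous_on_open_Un[OF \<Omega>(1) oC] 1 2 3 UN by metis+
    moreover have "h e x = 0" if "norm x > B" for x using B that by (auto simp: h_def not_le[symmetric])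
    ultimately show ?thesis
      using integral_compact_support_directional_deriv[OF der, of B] by blast
  qed
  have F: "F = (\<lambda>x. \<Sum>e\<in>Basis. h' e x)"
  proof
    fix x
    have "R x \<bullet> Y x = (\<Sum>e\<in>Basis. (R x \<bullet> e) * (Y x \<bullet> e))" by (rule euclidean_inner)
    thus "F x = (\<Sum>e\<in>Basis. h' e x)"
      by (cases "x \<in> \<Omega>")
        (simp_all add: F_def h'_def sum.distrib sum_distrib_left sum_divide_distrib mult_ac)
  qed
  show "integrable lborel F" "integral\<^sup>L lborel F = 0"
    unfolding F using hh by auto
qed

lemma integrable_indicator_continuous_bounded:
  fixes k :: "'a::euclidean_space \<Rightarrow> real"
  assumes "open \<Omega>" "bounded \<Omega>" "continuous_on \<Omega> k" "\<And>x. x \<in> \<Omega> \<Longrightarrow> \<bar>k x\<bar> \<le> M"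
  shows "integrable lborel (\<lambda>x. indicator \<Omega> x * k x)"
proof (rule Bochner_Integration.integrable_bound)
  have "emeasure lborel \<Omega> < \<infinity>" using assms(2) emeasure_bounded_finite by auto
  thus "integrable lborel (\<lambda>x. indicator \<Omega> x * M)"
    using assms(1) by (intro integrable_mult_left integrable_real_indicator) (auto simp: infinity_ennreal_def)
  show "(\<lambda>x. indicator \<Omega> x * k x) \<in> borel_measurable lborel"
    using borel_measurable_continuous_on_indicator[OF _ assms(3)] assms(1) by simp
  show "AE x in lborel. norm (indicator \<Omega> x * k x) \<le> norm (indicator \<Omega> x * M)"
    using assms(4) by (intro AE_I2) (fastforce simp: indicator_def)
qed

text \<open>Subtracting \<open>\<epsilon> Z\<close> makes the normal component strictly negative, hence negative in a whole
  boundary layer, so the cutoff term has a sign and its size is irrelevant.\<close>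
lemma divergence_inequality:
  fixes \<Omega> :: "'a::euclidean_space set" and X :: "'a \<Rightarrow> 'a" and DX :: "'a \<Rightarrow> 'a \<Rightarrow> real"
  assumes \<Omega>: "open \<Omega>" "bounded \<Omega>" "smooth_boundary \<Omega>" "outward_unit_normal \<Omega> \<nu>"
    and cX: "continuous_on (closure \<Omega>) X"
    and dX: "\<And>e x. e \<in> Basis \<Longrightarrow> x \<in> \<Omega> \<Longrightarrow>
      ((\<lambda>t. X (x + t *\<^sub>R e) \<bullet> e) has_real_derivative DX e x) (at 0)"
    and cDX: "\<And>e. e \<in> Basis \<Longrightarrow> continuous_on \<Omega> (DX e)"
    and bd: "\<And>q. q \<in> frontier \<Omega> \<Longrightarrow> X q \<bullet> \<nu> q \<le> 0"
    and k: "\<And>x. x \<in> \<Omega> \<Longrightarrow> k x \<le> (\<Sum>e\<in>Basis. DX e x)" "continuous_on \<Omega> k"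
      "\<And>x. x \<in> \<Omega> \<Longrightarrow> \<bar>k x\<bar> \<le> M"
  shows "(\<integral>x. indicator \<Omega> x * k x \<partial>lborel) \<le> 0"
proof -
  obtain \<rho> R and Z :: "'a \<Rightarrow> 'a" and DZ where
    \<rho>: "\<And>x. (\<rho> has_derivative (\<lambda>h. R x \<bullet> h)) (at x)" "continuous_on UNIV R"
    "\<And>x. x \<in> \<Omega> \<Longrightarrow> \<rho> x > 0" "\<And>q. q \<in> frontier \<Omega> \<Longrightarrow> \<rho> q = (0::real)"
    "\<And>q. q \<in> frontier \<Omega> \<Longrightarrow> \<exists>s>0. R q = (- s) *\<^sub>R \<nu> q" and
    Z: "\<And>x. (Z has_derivative DZ x) (at x)" "\<And>h. continuous_on UNIV (\<lambda>x. DZ x h)"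
    "\<And>q. q \<in> frontier \<Omega> \<Longrightarrow> Z q \<bullet> \<nu> q > 0"
    using global_defining_data[OF \<Omega>] by blast
  have c\<rho>: "continuous_on A \<rho>" and cZ: "continuous_on A Z" for A
    using \<rho>(1) Z(1) by (meson continuous_at_imp_continuous_on has_derivative_continuous)+
  have cR: "continuous_on A R" for A using \<rho>(2) continuous_on_subset by blast
  have compact: "compact (closure \<Omega>)" using \<Omega>(2) by (simp add: compact_closure)
  define dZ where "dZ x = (\<Sum>e\<in>Basis. DZ x e \<bullet> e)" for x
  have cdZ: "continuous_on A dZ" for A
    unfolding dZ_def[abs_def] by (intro continuous_intros continuous_on_subset[OF Z(2)]) auto
  obtain D where D: "\<And>x. x \<in> closure \<Omega> \<Longrightarrow> \<bar>dZ x\<bar> \<le> D"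
    using compact_imp_bounded[OF compact_continuous_image[OF cdZ compact]]
    by (metis bounded_iff image_eqI real_norm_def)
  define I where "I = (\<integral>x. indicator \<Omega> x * k x \<partial>lborel)"
  define \<mu> where "\<mu> = (\<integral>x. indicator \<Omega> x * D \<partial>lborel)"
  have intD: "integrable lborel (\<lambda>x. indicator \<Omega> x * D)"
    by (rule integrable_indicator_continuous_bounded[OF \<Omega>(1,2), of _ "\<bar>D\<bar>"]) auto
  have main: "I \<le> \<epsilon> * \<mu>" if \<epsilon>: "\<epsilon> > 0" for \<epsilon>
  proof -
    define Y where "Y x = X x - \<epsilon> *\<^sub>R Z x" for x
    define DY where "DY e x = DX e x - \<epsilon> * (DZ x e \<bullet> e)" for e x
    have cY: "continuous_on (closure \<Omega>) Y" unfolding Y_def by (intro continuous_intros cX cZ)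
    have cY': "continuous_on \<Omega> Y" using cY closure_subset continuous_on_subset by blast
    have dY: "((\<lambda>t. Y (x + t *\<^sub>R e) \<bullet> e) has_real_derivative DY e x) (at 0)"
      if "e \<in> Basis" "x \<in> \<Omega>" for e x
    proof -
      have "((\<lambda>y. Z y \<bullet> e) has_derivative (\<lambda>h. DZ x h \<bullet> e)) (at x)"
        by (intro has_derivative_inner_left Z(1))
      from DERIV_diff[OF dX[OF that] DERIV_cmult[OF has_real_derivative_along_line[OF this, of e], of \<epsilon>]]
      show ?thesis by (simp add: Y_def DY_def inner_diff_left)
    qed
    have cDY: "continuous_on \<Omega> (DY e)" if "e \<in> Basis" for e
      unfolding DY_def
      by (intro continuous_intros cDX[OF that] continuous_on_subset[OF Z(2)]) auto
    \<comment> \<open>Off \<open>S\<close> the factor \<open>R \<bullet> Y\<close> has the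
      favourable sign. \<open>S\<close> avoids the boundary, where \<open>R\<close> is a negative
      multiple of the normal and \<open>Y \<bullet> \<nu>\<close> is negative; being compact, it
      lies in \<open>\<rho> \<ge> m\<close> for some \<open>m > 0\<close>.\<close>
    define S where "S = {x\<in>closure \<Omega>. R x \<bullet> Y x \<le> 0}"
    have "closed S" unfolding S_def
      using continuous_closed_preimage[OF continuous_on_inner[OF cR cY] closed_closure, of "{..0}"]
      by (simp add: vimage_def Int_def)
    hence compS: "compact S"
      using compact S_def by (metis (no_types, lifting) compact_Int_closed inf.absorb2 mem_Collect_eq subsetI)
    have "\<rho> x > 0" if x: "x \<in> S" for x
    proof (cases "x \<in> \<Omega>")
      case False
      hence q: "x \<in> frontier \<Omega>" using x \<Omega>(1) by (auto simp: S_def frontier_def interior_open)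
      then obtain s where s: "s > 0" "R x = (- s) *\<^sub>R \<nu> x" using \<rho>(5) by blast
      have "Y x \<bullet> \<nu> x < 0"
        using bd[OF q] mult_pos_pos[OF \<epsilon> Z(3)[OF q]] by (simp add: Y_def inner_diff_left)
      hence "R x \<bullet> Y x > 0" using s by (simp add: inner_commute mult_less_0_iff)
      thus ?thesis using x by (simp add: S_def)
    qed (use \<rho>(3) in auto)
    note pos = this
    have "\<exists>m>0. \<forall>x\<in>S. \<rho> x \<ge> m"
    proof (cases "S = {}")
      case False
      then obtain y where "y \<in> S" "\<forall>x\<in>S. \<rho> y \<le> \<rho> x"
        using continuous_attains_inf[OF compS _ c\<rho>] by blast
      thus ?thesis using pos by blast
    qed (auto intro: zero_less_one)
    then obtain m where m: "m > 0" "\<And>x. x \<in> S \<Longrightarrow> \<rho> x \<ge> m" by blast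
    \<comment> \<open>The halving matters: the derivative of the cutoff lives where
      \<open>\<rho> < 2 * \<delta> n\<close>, and this region has to lie in the good layer
      \<open>\<rho> < m\<close>.\<close>
    define \<delta> where "\<delta> n = m / 2 * inverse (real (Suc n))" for n
    have \<delta>: "\<delta> n > 0" "2 * \<delta> n \<le> m" for n using m by (auto simp: \<delta>_def field_simps)
    define s where "s n x = indicator \<Omega> x * (cutoff (\<rho> x / \<delta> n) * k x)" for n x
    have cs: "continuous_on \<Omega> (\<lambda>x. cutoff (\<rho> x / \<delta> n) * k x)" for n
      using \<delta>(1)[of n] by (auto intro!: continuous_intros k(2) c\<rho>
          continuous_on_compose2[OF continuous_on_cutoff(1)[of UNIV]])
    have bs: "\<bar>cutoff t * k x\<bar> \<le> M" if "x \<in> \<Omega>" for t x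
    proof -
      have "\<bar>cutoff t * k x\<bar> \<le> \<bar>k x\<bar>"
        using cutoff_bounds(1,2)[of t] by (simp add: abs_mult mult_left_le_one_le)
      thus ?thesis using k(3)[OF that] by linarith
    qed
    have ints: "integrable lborel (s n)" for n
      unfolding s_def using integrable_indicator_continuous_bounded[OF \<Omega>(1,2) cs bs] by blast
    have le: "integral\<^sup>L lborel (s n) \<le> \<epsilon> * \<mu>" for n
    proof -
      define F where "F = (\<lambda>x. indicator \<Omega> x * (cutoff' (\<rho> x / \<delta> n) / \<delta> n * (R x \<bullet> Y x)
        + cutoff (\<rho> x / \<delta> n) * (\<Sum>e\<in>Basis. DY e x)))"
      have F: "integrable lborel F" "integral\<^sup>L lborel F = 0"
        unfolding F_def
        by (rule integral_divergence_cutoff[OF \<Omega>(1,2) \<rho>(1,2,4) cY' dY cDY \<delta>(1)]; assumption)+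
      have "s n x \<le> F x + \<epsilon> * (indicator \<Omega> x * D)" for x
      proof (cases "x \<in> \<Omega>")
        case True
        define c where "c = cutoff (\<rho> x / \<delta> n)"
        have c: "0 \<le> c" "c \<le> 1" using cutoff_bounds by (auto simp: c_def)
        have "0 \<le> cutoff' (\<rho> x / \<delta> n) / \<delta> n * (R x \<bullet> Y x)"
        proof (cases "\<rho> x < 2 * \<delta> n")
          case layer: True
          hence "x \<notin> S" using m(2)[of x] \<delta>(2)[of n] by auto
          hence "R x \<bullet> Y x \<ge> 0" using True closure_subset by (auto simp: S_def)
          thus ?thesis using \<delta>(1)[of n] cutoff_bounds(3) by simp
        next
          case False
          hence "\<rho> x / \<delta> n \<ge> 2" using \<delta>(1)[of n] by (simp add: field_simps)
          thus ?thesis by (simp add: cutoff_ge_2)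
        qed
        moreover have "c * k x \<le> c * (\<Sum>e\<in>Basis. DX e x)"
          using k(1)[OF True] c(1) by (rule mult_left_mono)
        moreover have "(\<Sum>e\<in>Basis. DX e x) = (\<Sum>e\<in>Basis. DY e x) + \<epsilon> * dZ x"
          by (simp add: DY_def dZ_def sum_subtractf sum_distrib_left)
        moreover have "c * (\<epsilon> * dZ x) \<le> \<epsilon> * D"
        proof -
          have "x \<in> closure \<Omega>" using True closure_subset by blast
          hence "dZ x \<le> D" "0 \<le> D" using D[of x] by linarith+
          hence "c * dZ x \<le> c * D" "c * D \<le> D"
            using c by (simp_all add: mult_left_mono mult_left_le_one_le)
          hence "c * dZ x \<le> D" by linarith
          thus ?thesis using \<epsilon> by (simp add: mult.left_commute)
        qed
        ultimately show ?thesis using True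
          by (simp add: s_def F_def c_def[symmetric] distrib_left)
      qed (simp add: s_def F_def)
      hence "integral\<^sup>L lborel (s n) \<le> integral\<^sup>L lborel (\<lambda>x. F x + \<epsilon> * (indicator \<Omega> x * D))"
        by (intro integral_mono ints Bochner_Integration.integrable_add F integrable_mult_right intD)
      also have "\<dots> = \<epsilon> * \<mu>"
        using F intD by (simp add: \<mu>_def)
      finally show ?thesis .
    qed
    have "(\<lambda>n. integral\<^sup>L lborel (s n)) \<longlonglongrightarrow> I"
      unfolding I_def
    proof (rule integral_dominated_convergence)
      show "integrable lborel (\<lambda>x. indicator \<Omega> x * M)"
        by (rule integrable_indicator_continuous_bounded[OF \<Omega>(1,2), of _ "\<bar>M\<bar>"]) auto
      show "(\<lambda>x. indicator \<Omega> x * k x) \<in> borel_measurable lborel"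
        using integrable_indicator_continuous_bounded[OF \<Omega>(1,2) k(2,3)] by (rule borel_measurable_integrable)
      show "s n \<in> borel_measurable lborel" for n
        using ints by (rule borel_measurable_integrable)
      show "AE x in lborel. norm (s n x) \<le> indicator \<Omega> x * M" for n
      proof (rule AE_I2)
        show "norm (s n x) \<le> indicator \<Omega> x * M" for x
          using bs[of x "\<rho> x / \<delta> n"] by (cases "x \<in> \<Omega>") (simp_all add: s_def)
      qed
      show "AE x in lborel. (\<lambda>n. s n x) \<longlonglongrightarrow> indicator \<Omega> x * k x"
      proof (rule AE_I2)
        fix x
        show "(\<lambda>n. s n x) \<longlonglongrightarrow> indicator \<Omega> x * k x"
        proof (cases "x \<in> \<Omega>")
          case True
          have "\<delta> \<longlonglongrightarrow> m / 2 * 0"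
            unfolding \<delta>_def[abs_def]
            by (rule tendsto_mult[OF tendsto_const LIMSEQ_inverse_real_of_nat])
          hence "\<forall>\<^sub>F n in sequentially. \<delta> n < \<rho> x / 2"
            using \<rho>(3)[OF True] by (intro order_tendstoD(2)) auto
          hence "\<forall>\<^sub>F n in sequentially. s n x = indicator \<Omega> x * k x"
          proof eventually_elim
            case (elim n)
            hence "\<rho> x / \<delta> n \<ge> 2" using \<delta>(1)[of n] by (simp add: field_simps)
            thus ?case by (simp add: s_def cutoff_ge_2)
          qed
          thus ?thesis by (rule tendsto_eventually)
        qed (simp add: s_def)
      qed
    qed
    thus ?thesis using le by (intro LIMSEQ_le_const2) auto
  qed
  have "((\<lambda>\<epsilon>. \<epsilon> * \<mu>) \<longlongrightarrow> 0 * \<mu>) (at_right (0::real))" by (intro tendsto_intros)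
  moreover have "\<forall>\<^sub>F \<epsilon> in at_right 0. I \<le> \<epsilon> * \<mu>"
    using main by (auto simp: eventually_at_right_field intro: exI[of _ 1])
  ultimately have "I \<le> 0 * \<mu>"
    by (intro tendsto_lowerbound[of _ "0 * \<mu>" "at_right (0::real)" I]) auto
  thus ?thesis by (simp add: I_def)
qed

section \<open>Maximum principles\<close>

text \<open>At the minimum the first derivative vanishes; a negative second derivative would make
  \<open>f1\<close> negative just past \<open>x\<close>, and the mean value theorem would produce a
  smaller value of \<open>f\<close>.\<close>

lemma second_derivative_nonneg_at_local_min:
  fixes f f1 f2 :: "'a::real_normed_vector \<Rightarrow> real"
  assumes S: "open S" "x \<in> S"
    and f1: "\<And>y. y \<in> S \<Longrightarrow> ((\<lambda>t. f (y + t *\<^sub>R e)) has_real_derivative f1 y) (at 0)"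
    and f2: "((\<lambda>t. f1 (x + t *\<^sub>R e)) has_real_derivative f2 x) (at 0)"
    and min: "\<And>y. y \<in> S \<Longrightarrow> f x \<le> f y"
  shows "f2 x \<ge> 0"
proof (rule ccontr)
  assume neg: "\<not> f2 x \<ge> 0"
  obtain d where d: "d > 0" "\<And>t. \<bar>t\<bar> < d \<Longrightarrow> x + t *\<^sub>R e \<in> S"
    using eventually_along_line[OF S, of e] by (auto simp: eventually_nhds_metric dist_real_def)
  have der: "((\<lambda>t. f (x + t *\<^sub>R e)) has_real_derivative f1 (x + t *\<^sub>R e)) (at t)" if "\<bar>t\<bar> < d" for t
    using f1[OF d(2)[OF that]] by (rule has_real_derivative_line_shift)
  have "f1 (x + 0 *\<^sub>R e) = 0"
    by (rule DERIV_local_min[OF der d(1)]) (use d min in auto)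
  moreover obtain d' where d': "d' > 0" "\<And>t. 0 < t \<Longrightarrow> t < d' \<Longrightarrow> f1 (x + (0 + t) *\<^sub>R e) < f1 (x + 0 *\<^sub>R e)"
    using DERIV_neg_dec_right[OF f2] neg by auto
  ultimately have neg': "f1 (x + t *\<^sub>R e) < 0" if "0 < t" "t < d'" for t using that by simp
  define t where "t = min d d' / 2"
  have t: "0 < t" "t < d" "t < d'" using d d' by (auto simp: t_def)
  obtain z where z: "0 < z" "z < t" "f (x + t *\<^sub>R e) - f (x + 0 *\<^sub>R e) = (t - 0) * f1 (x + z *\<^sub>R e)"
    using MVT2[OF t(1), of "\<lambda>t. f (x + t *\<^sub>R e)" "\<lambda>t. f1 (x + t *\<^sub>R e)"] der t by auto
  have "t * f1 (x + z *\<^sub>R e) < 0" using neg'[of z] z t by (simp add: mult_pos_neg)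
  hence "f (x + t *\<^sub>R e) < f x" using z by simp
  thus False using min[of "x + t *\<^sub>R e"] d(2)[of t] t by auto
qed

text \<open>A boundary point of an open set is a limit point of it, so the limit defining
  \<open>boundary_grad\<close> is unique and every continuous extension of the gradient attains
  it.\<close>

lemma boundary_grad_eq:
  assumes "open S" "p \<in> frontier S" "continuous_on (closure S) G" "\<And>x. x \<in> S \<Longrightarrow> G x = grad f x"
  shows "boundary_grad S f p = G p"
proof -
  have p: "p \<in> closure S" "p \<notin> S" using assms(1,2) by (auto simp: frontier_def interior_open)
  hence "p islimpt S" by (auto simp: closure_def)
  hence nt: "at p within S \<noteq> bot" by (simp add: trivial_limit_within)
  have "(G \<longlongrightarrow> G p) (at p within S)"
    using assms(3) p closure_subset by (meson continuous_on_def tendsto_within_subset)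
  hence "(grad f \<longlongrightarrow> G p) (at p within S)"
    by (rule Lim_transform_eventually) (auto simp: eventually_at_filter assms(4))
  thus ?thesis unfolding boundary_grad_def using tendsto_Lim[OF nt] by blast
qed

text \<open>Were the derivative negative, continuity of the extended gradient would keep
  \<open>grad f \<bullet> \<nu> p\<close> negative on a short inward segment, and \<open>f\<close>
  would grow along it beyond its maximum. Derivatives are taken on the open segment only, continuity
  covers its endpoint \<open>p\<close>.\<close>

lemma normal_deriv_nonneg_at_max:
  assumes \<Omega>: "open \<Omega>" "outward_unit_normal \<Omega> \<nu>" and f: "C1_closure f \<Omega>"
    and p: "p \<in> frontier \<Omega>" and max: "\<And>x. x \<in> \<Omega> \<Longrightarrow> f x \<le> f p"
  shows "normal_deriv \<Omega> \<nu> f p \<ge> 0"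
proof (rule ccontr)
  assume neg: "\<not> normal_deriv \<Omega> \<nu> f p \<ge> 0"
  obtain G where G: "continuous_on (closure \<Omega>) G" "\<And>x. x \<in> \<Omega> \<Longrightarrow> G x = grad f x"
    using f by (auto simp: C1_closure_def)
  have Gp: "G p \<bullet> \<nu> p < 0"
    using neg boundary_grad_eq[OF \<Omega>(1) p G] by (simp add: normal_deriv_def)
  obtain t0 where t0: "t0 > 0" "\<And>t. 0 < t \<Longrightarrow> t < t0 \<Longrightarrow> p - t *\<^sub>R \<nu> p \<in> \<Omega>"
    using outward_unit_normal_inward[OF \<Omega>(2) p] by (auto simp: eventually_at_right_field)
  have pc: "p \<in> closure \<Omega>" using p by (auto simp: frontier_def)
  have cl: "p - t *\<^sub>R \<nu> p \<in> closure \<Omega>" if "t \<in> {0..<t0}" for t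
    using that t0(2)[of t] pc closure_subset by (cases "t = 0") auto
  have "continuous_on {0..<t0} (\<lambda>t. G (p - t *\<^sub>R \<nu> p) \<bullet> \<nu> p)"
    by (intro continuous_intros continuous_on_compose2[OF G(1)]) (use cl in auto)
  hence "((\<lambda>t. G (p - t *\<^sub>R \<nu> p) \<bullet> \<nu> p) \<longlongrightarrow> G (p - 0 *\<^sub>R \<nu> p) \<bullet> \<nu> p) (at 0 within {0..<t0})"
    unfolding continuous_on_def by (rule bspec) (use t0(1) in auto)
  hence "\<forall>\<^sub>F t in at 0 within {0..<t0}. G (p - t *\<^sub>R \<nu> p) \<bullet> \<nu> p < 0"
    by (rule order_tendstoD) (use Gp in simp)
  then obtain d where d: "d > 0" "\<And>t. t \<in> {0..<t0} \<Longrightarrow> t \<noteq> 0 \<Longrightarrow> \<bar>t\<bar> < d \<Longrightarrow> G (p - t *\<^sub>R \<nu> p) \<bullet> \<nu> p < 0"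
    by (auto simp: eventually_at dist_real_def)
  define t where "t = min d t0 / 2"
  have t: "0 < t" "t < d" "t < t0" using d t0 by (auto simp: t_def)
  have "f (p - 0 *\<^sub>R \<nu> p) < f (p - t *\<^sub>R \<nu> p)"
  proof (rule DERIV_pos_imp_increasing_open[OF t(1), of "\<lambda>s. f (p - s *\<^sub>R \<nu> p)"])
    fix s assume s: "0 < s" "s < t"
    have in\<Omega>: "p - s *\<^sub>R \<nu> p \<in> \<Omega>" using t0(2) s t by auto
    have "f differentiable (at (p - s *\<^sub>R \<nu> p))"
      using f in\<Omega> \<Omega>(1) by (simp add: C1_closure_def differentiable_on_eq_differentiable_at)
    from has_real_derivative_along_line[OF grad_has_derivative[OF this], of "- \<nu> p"]
    have "((\<lambda>t. f (p + s *\<^sub>R (- \<nu> p) + t *\<^sub>R (- \<nu> p))) has_real_derivative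
        grad f (p - s *\<^sub>R \<nu> p) \<bullet> (- \<nu> p)) (at 0)"
      by simp
    hence "((\<lambda>s. f (p + s *\<^sub>R (- \<nu> p))) has_real_derivative grad f (p - s *\<^sub>R \<nu> p) \<bullet> (- \<nu> p)) (at s)"
      by (rule has_real_derivative_line_shift)
    moreover have "grad f (p - s *\<^sub>R \<nu> p) \<bullet> (- \<nu> p) > 0"
      using d(2)[of s] s t unfolding G(2)[OF in\<Omega>] by simp
    ultimately have "((\<lambda>s. f (p + s *\<^sub>R (- \<nu> p))) has_real_derivative grad f (p - s *\<^sub>R \<nu> p) \<bullet> (- \<nu> p)) (at s)
        \<and> grad f (p - s *\<^sub>R \<nu> p) \<bullet> (- \<nu> p) > 0" ..
    thus "\<exists>y. ((\<lambda>s. f (p - s *\<^sub>R \<nu> p)) has_real_derivative y) (at s) \<and> y > 0"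
      by (intro exI[of _ "grad f (p - s *\<^sub>R \<nu> p) \<bullet> (- \<nu> p)"]) simp
  next
    have cf: "continuous_on (closure \<Omega>) f" using f by (simp add: C1_closure_def)
    have cp: "continuous_on {0..t} (\<lambda>s. p - s *\<^sub>R \<nu> p)" by (intro continuous_intros)
    show "continuous_on {0..t} (\<lambda>s. f (p - s *\<^sub>R \<nu> p))"
      by (rule continuous_on_compose2[OF cf cp]) (use cl t in auto)
  qed
  thus False using max[OF t0(2)[OF t(1,3)]] by simp
qed

section \<open>Hopf barrier and strong minimum principle\<close>

text \<open>Comparison with Hopf's Gaussian barrier, which is zero on the outer sphere. For large
  \<open>k\<close> its Laplacian exceeds \<open>C\<close> times itself on the annulus, so
  \<open>f\<close> minus a suitable multiple of it has no negative minimum there. The lower bound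
  grows linearly away from the outer sphere.\<close>

lemma Hopf_barrier:
  fixes f :: "'a::euclidean_space \<Rightarrow> real"
  assumes r: "r > 0" "cball c r \<subseteq> \<Omega>" and C: "C \<ge> 0"
    and cont: "continuous_on \<Omega> f" and nonneg: "\<And>x. x \<in> \<Omega> \<Longrightarrow> f x \<ge> 0"
    and pos: "\<And>x. x \<in> ball c r \<Longrightarrow> f x > 0"
    and f1: "\<And>e x. e \<in> Basis \<Longrightarrow> x \<in> \<Omega> \<Longrightarrow> ((\<lambda>t. f (x + t *\<^sub>R e)) has_real_derivative f1 e x) (at 0)"
    and f2: "\<And>e x. e \<in> Basis \<Longrightarrow> x \<in> \<Omega> \<Longrightarrow> ((\<lambda>t. f1 e (x + t *\<^sub>R e)) has_real_derivative f2 e x) (at 0)"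
    and lap: "\<And>x. x \<in> \<Omega> \<Longrightarrow> (\<Sum>e\<in>Basis. f2 e x) \<le> C * f x"
  shows "\<exists>\<epsilon>>0. \<exists>k>0. \<forall>x\<in>cball c r - ball c (r / 2).
    \<epsilon> * (exp (- k * ((x - c) \<bullet> (x - c))) - exp (- k * r\<^sup>2)) \<le> f x"
proof -
  define n where "n = real DIM('a)"
  \<comment> \<open>On the annulus the squared distance is at least \<open>r\<^sup>2 / 4\<close>, so
    the Laplacian of the barrier is at least \<open>k * (k * r\<^sup>2 - 2 * n)\<close> times
    \<open>E\<close>. This \<open>k\<close> makes the factor at least \<open>C + 1\<close>; its last
    summand secures \<open>k \<ge> 1\<close>.\<close>
  define k where "k = (2 * n + C + 1) / r\<^sup>2 + 1"
  have n: "n \<ge> 0" by (simp add: n_def)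
  have k1: "k \<ge> 1" using C r n by (simp add: k_def)
  have k2: "k * (k * r\<^sup>2 - 2 * n) \<ge> C + 1"
  proof -
    have "k * r\<^sup>2 - 2 * n = C + 1 + r\<^sup>2" using r by (simp add: k_def field_simps)
    hence "k * r\<^sup>2 - 2 * n \<ge> C + 1" by simp
    hence "1 * (C + 1) \<le> k * (k * r\<^sup>2 - 2 * n)" using k1 C by (intro mult_mono) auto
    thus ?thesis by simp
  qed
  define E where "E x = exp (- k * ((x - c) \<bullet> (x - c)))" for x
  define h where "h x = E x - exp (- k * r\<^sup>2)" for x
  define h1 where "h1 e x = - 2 * k * ((x - c) \<bullet> e) * E x" for e x
  define h2 where "h2 e x = (4 * k\<^sup>2 * ((x - c) \<bullet> e)\<^sup>2 - 2 * k) * E x" for e x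
  have E': "((\<lambda>t. E (x + t *\<^sub>R e)) has_real_derivative h1 e x) (at 0)" for e x
  proof -
    have "(E has_derivative (\<lambda>v. h1 v x)) (at x)"
      unfolding E_def[abs_def] h1_def
      by (auto intro!: derivative_eq_intros simp: inner_commute algebra_simps)
    thus ?thesis by (rule has_real_derivative_along_line)
  qed
  have h1: "((\<lambda>t. h (x + t *\<^sub>R e)) has_real_derivative h1 e x) (at 0)" for e x
    unfolding h_def using DERIV_diff[OF E' DERIV_const] by simp
  have h2: "((\<lambda>t. h1 e (x + t *\<^sub>R e)) has_real_derivative h2 e x) (at 0)" if "e \<in> Basis" for e x
  proof -
    have "((\<lambda>t. - 2 * k * ((x + t *\<^sub>R e - c) \<bullet> e)) has_real_derivative - 2 * k) (at 0)"
      using that by (auto intro!: derivative_eq_intros simp: inner_add_left inner_diff_left)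
    from DERIV_mult[OF this E'[of x e]] show ?thesis
      unfolding h1_def h2_def by (simp add: algebra_simps power2_eq_square)
  qed
  have sum_h2: "(\<Sum>e\<in>Basis. h2 e x) = (4 * k\<^sup>2 * ((x - c) \<bullet> (x - c)) - 2 * k * n) * E x" for x
  proof -
    have "(x - c) \<bullet> (x - c) = (\<Sum>e\<in>Basis. ((x - c) \<bullet> e)\<^sup>2)"
      by (subst euclidean_inner) (simp add: power2_eq_square)
    thus ?thesis
      by (simp add: h2_def sum_subtractf sum_distrib_left sum_distrib_right n_def left_diff_distrib)
  qed
  have dist: "(x - c) \<bullet> (x - c) = (dist c x)\<^sup>2" for x
    by (metis dist_commute dist_norm power2_norm_eq_inner)
  have cont_cball: "continuous_on (cball c r) f" using cont r(2) continuous_on_subset by blast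
  have sub: "cball c (r / 2) \<subseteq> ball c r" using r by auto
  have "\<exists>y\<in>cball c (r / 2). \<forall>x\<in>cball c (r / 2). f y \<le> f x"
    by (intro continuous_attains_inf continuous_on_subset[OF cont_cball]) (use r in auto)
  then obtain y where y: "y \<in> cball c (r / 2)" "\<And>x. x \<in> cball c (r / 2) \<Longrightarrow> f y \<le> f x" by blast
  \<comment> \<open>The barrier is at most 1, so taking the minimum of \<open>f\<close> over the
    inner ball as multiple keeps \<open>W\<close> nonnegative on the inner sphere.\<close>
  define m where "m = f y"
  have m: "m > 0" using pos y(1) sub by (auto simp: m_def)
  define A where "A = cball c r - ball c (r / 2)"
  define W where "W x = f x - m * h x" for x
  have "W x \<ge> 0" if xA: "x \<in> A" for x
  proof (rule ccontr)
    assume "\<not> W x \<ge> 0"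
    have "compact A" unfolding A_def by (intro compact_diff) auto
    moreover have "continuous_on A W"
      unfolding W_def h_def E_def A_def
      by (intro continuous_intros continuous_on_subset[OF cont_cball]) auto
    ultimately obtain z where z: "z \<in> A" "\<And>x. x \<in> A \<Longrightarrow> W z \<le> W x"
      using continuous_attains_inf[of A W] xA by blast
    have Wz: "W z < 0" using z(2)[OF xA] \<open>\<not> W x \<ge> 0\<close> by simp
    have z\<Omega>: "z \<in> \<Omega>" using z r by (auto simp: A_def)
    have "dist c z \<noteq> r"
    proof
      assume "dist c z = r"
      hence "h z = 0" by (simp add: h_def E_def dist)
      thus False using nonneg[OF z\<Omega>] Wz by (simp add: W_def)
    qed
    moreover have "dist c z \<noteq> r / 2"
    proof
      assume "dist c z = r / 2"
      hence "f z \<ge> m" using y(2) by (simp add: m_def)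
      moreover have "E z \<le> 1" using k1 by (simp add: E_def)
      hence "h z \<le> 1" unfolding h_def using exp_gt_zero[of "- k * r\<^sup>2"] by linarith
      hence "m * h z \<le> m" using m by simp
      ultimately show False using Wz by (simp add: W_def)
    qed
    ultimately have zS: "z \<in> ball c r - cball c (r / 2)" using z by (auto simp: A_def)
    define S where "S = ball c r - cball c (r / 2)"
    have S: "open S" "S \<subseteq> A" "S \<subseteq> \<Omega>" using r by (auto simp: S_def A_def)
    have "f2 e z - m * h2 e z \<ge> 0" if e: "e \<in> Basis" for e
    proof (rule second_derivative_nonneg_at_local_min[where f = W and S = S and x = z
          and ?f1.0 = "\<lambda>x. f1 e x - m * h1 e x" and ?f2.0 = "\<lambda>x. f2 e x - m * h2 e x"])
      show "((\<lambda>t. W (y + t *\<^sub>R e)) has_real_derivative f1 e y - m * h1 e y) (at 0)" if "y \<in> S" for y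
        unfolding W_def using that S(3)
        by (intro DERIV_diff DERIV_cmult h1 f1[OF e]) auto
      show "((\<lambda>t. f1 e (z + t *\<^sub>R e) - m * h1 e (z + t *\<^sub>R e)) has_real_derivative f2 e z - m * h2 e z) (at 0)"
        using z\<Omega> by (intro DERIV_diff DERIV_cmult h2 f2 e)
    qed (use S z zS in \<open>auto simp: S_def[symmetric]\<close>)
    hence "(\<Sum>e\<in>Basis. f2 e z - m * h2 e z) \<ge> 0" by (intro sum_nonneg)
    \<comment> \<open>The Laplacian of \<open>W\<close> is nonnegative at the minimum. Together with
      the upper bound for \<open>f\<close> and the lower bound for the barrier this forces
      \<open>C * W z > 0\<close>, against \<open>W z < 0\<close>.\<close>
    hence "m * (\<Sum>e\<in>Basis. h2 e z) \<le> C * f z"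
      using lap[OF z\<Omega>] by (simp add: sum_subtractf sum_distrib_left)
    moreover have "(\<Sum>e\<in>Basis. h2 e z) \<ge> (C + 1) * E z"
    proof -
      have "(r / 2)\<^sup>2 \<le> (z - c) \<bullet> (z - c)"
        unfolding dist using r zS by (intro power_mono) auto
      hence "4 * k\<^sup>2 * (r / 2)\<^sup>2 \<le> 4 * k\<^sup>2 * ((z - c) \<bullet> (z - c))" by (intro mult_left_mono) auto
      moreover have "4 * k\<^sup>2 * (r / 2)\<^sup>2 - 2 * k * n = k * (k * r\<^sup>2 - 2 * n)"
        by (simp add: power2_eq_square algebra_simps)
      ultimately have "C + 1 \<le> 4 * k\<^sup>2 * ((z - c) \<bullet> (z - c)) - 2 * k * n" using k2 by simp
      thus ?thesis unfolding sum_h2 by (intro mult_right_mono) (auto simp: E_def)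
    qed
    moreover have "(C + 1) * E z > C * h z"
    proof -
      have "C * h z \<le> C * E z" using C by (intro mult_left_mono) (auto simp: h_def)
      moreover have "E z > 0" by (simp add: E_def)
      ultimately show ?thesis by (simp add: distrib_right)
    qed
    ultimately have "C * h z < (\<Sum>e\<in>Basis. h2 e z)" "m * (\<Sum>e\<in>Basis. h2 e z) \<le> C * f z"
      by linarith+
    hence "m * (C * h z) < C * f z"
      using mult_strict_left_mono[OF _ m] by fastforce
    hence "C * W z > 0" by (simp add: W_def algebra_simps)
    thus False using C Wz by (simp add: zero_less_mult_iff)
  qed
  hence "\<forall>x\<in>A. m * (exp (- k * ((x - c) \<bullet> (x - c))) - exp (- k * r\<^sup>2)) \<le> f x"
    by (simp add: W_def h_def E_def)
  thus ?thesis using m k1 unfolding A_def by (intro exI[of _ m] exI[of _ k] conjI) auto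
qed

text \<open>Otherwise, by connectedness, the zero set is not open, and some ball of positivity
  touches a zero inside \<open>\<Omega>\<close>. The derivative of \<open>f\<close> vanishes there,
  as at any interior minimum, while the barrier makes \<open>f\<close> grow linearly into the
  ball.\<close>

lemma strong_minimum_principle:
  fixes f :: "'a::euclidean_space \<Rightarrow> real"
  assumes \<Omega>: "open \<Omega>" "connected \<Omega>" and C: "C \<ge> 0"
    and diff: "\<And>x. x \<in> \<Omega> \<Longrightarrow> f differentiable (at x)" and nonneg: "\<And>x. x \<in> \<Omega> \<Longrightarrow> f x \<ge> 0"
    and f1: "\<And>e x. e \<in> Basis \<Longrightarrow> x \<in> \<Omega> \<Longrightarrow> ((\<lambda>t. f (x + t *\<^sub>R e)) has_real_derivative f1 e x) (at 0)"
    and f2: "\<And>e x. e \<in> Basis \<Longrightarrow> x \<in> \<Omega> \<Longrightarrow> ((\<lambda>t. f1 e (x + t *\<^sub>R e)) has_real_derivative f2 e x) (at 0)"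
    and lap: "\<And>x. x \<in> \<Omega> \<Longrightarrow> (\<Sum>e\<in>Basis. f2 e x) \<le> C * f x"
    and nz: "\<exists>x\<in>\<Omega>. f x \<noteq> 0" and x: "x \<in> \<Omega>"
  shows "f x > 0"
proof (rule ccontr)
  assume "\<not> f x > 0"
  hence fx: "f x = 0" using nonneg[OF x] by simp
  have cont: "continuous_on \<Omega> f"
    using diff by (meson continuous_at_imp_continuous_on differentiable_imp_continuous_within)
  define P where "P = {x\<in>\<Omega>. f x > 0}"
  define Z where "Z = {x\<in>\<Omega>. f x = 0}"
  have "open P" unfolding P_def
    using continuous_open_preimage[OF cont \<Omega>(1) open_greaterThan, of 0] by (simp add: vimage_def Int_def)
  moreover have PZ: "\<Omega> = P \<union> Z" "P \<inter> Z = {}" using nonneg by (auto simp: P_def Z_def less_le)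
  moreover have "P \<noteq> {}" "Z \<noteq> {}" using nz nonneg x fx by (auto simp: P_def Z_def less_le)
  ultimately have "\<not> open Z" using \<Omega>(2) connectedD[of \<Omega> P Z] by blast
  then obtain z where z: "z \<in> Z" "\<And>s. s > 0 \<Longrightarrow> \<not> ball z s \<subseteq> Z" by (auto simp: open_contains_ball)
  have "z \<in> \<Omega>" using z by (simp add: Z_def)
  \<comment> \<open>The factor 2 leaves room: for \<open>c\<close> within \<open>s\<close> of
    \<open>z\<close>, the closed ball of radius \<open>s\<close> around \<open>c\<close> stays in
    the domain.\<close>
  then obtain s where s: "s > 0" "ball z (2 * s) \<subseteq> \<Omega>"
    using \<Omega>(1) by (metis open_contains_ball field_sum_of_halves half_gt_zero mult_2)
  obtain c where c: "c \<in> ball z s" "c \<notin> Z" using z(2)[OF s(1)] by blast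
  have "c \<in> \<Omega>" using c s by auto
  hence cP: "c \<in> P" using c PZ by blast
  \<comment> \<open>The zero nearest to \<open>c\<close> lies on the sphere bounding the largest
    ball of positivity around \<open>c\<close>; searching only in \<open>cball c s\<close> loses
    nothing, because \<open>z\<close> is in it.\<close>
  define K where "K = cball c s \<inter> f -` {0}"
  have csub: "cball c s \<subseteq> \<Omega>"
  proof
    fix y assume "y \<in> cball c s"
    hence "dist z y < 2 * s" using c(1) dist_triangle[of z y c] by auto
    thus "y \<in> \<Omega>" using s by auto
  qed
  have "closed K" unfolding K_def
    by (rule continuous_closed_preimage) (auto intro: continuous_on_subset[OF cont csub])
  moreover have zK: "z \<in> K" using z c by (auto simp: K_def Z_def dist_commute)
  ultimately obtain x0 where x0: "x0 \<in> K" "\<And>y. y \<in> K \<Longrightarrow> dist c x0 \<le> dist c y"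
    using distance_attains_inf[of K c] by auto
  define r where "r = dist c x0"
  have "c \<noteq> x0" using cP x0 by (auto simp: K_def P_def)
  hence r0: "r > 0" by (simp add: r_def)
  have rs: "r < s" using x0(2)[OF zK] c by (auto simp: r_def dist_commute)
  have sub: "cball c r \<subseteq> \<Omega>" using csub rs by auto
  have x0\<Omega>: "x0 \<in> \<Omega>" "f x0 = 0" using x0 csub by (auto simp: K_def)
  have pos: "f y > 0" if y: "y \<in> ball c r" for y
  proof -
    have "y \<notin> K" using x0(2)[of y] y by (auto simp: r_def)
    hence "f y \<noteq> 0" using y rs by (auto simp: K_def)
    moreover have "y \<in> \<Omega>" using y sub by auto
    ultimately show ?thesis using nonneg by (simp add: less_le)
  qed
  obtain \<epsilon> k where k: "\<epsilon> > 0" "k > 0"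
    "\<And>x. x \<in> cball c r - ball c (r / 2) \<Longrightarrow> \<epsilon> * (exp (- k * ((x - c) \<bullet> (x - c))) - exp (- k * r\<^sup>2)) \<le> f x"
    using Hopf_barrier[OF r0 sub C cont nonneg pos f1 f2 lap] by blast
  \<comment> \<open>\<open>W\<close> vanishes at \<open>x0\<close> and is nonnegative in the
    annulus, but its derivative at \<open>x0\<close> towards \<open>c\<close> comes from the barrier
    alone and is negative.\<close>
  define W where "W y = f y - \<epsilon> * (exp (- k * ((y - c) \<bullet> (y - c))) - exp (- k * r\<^sup>2))" for y
  define w where "w = c - x0"
  have ww: "(x0 - c) \<bullet> (x0 - c) = r\<^sup>2"
    unfolding r_def by (metis dist_commute dist_norm power2_norm_eq_inner)
  have "(f has_derivative (\<lambda>v. grad f x0 \<bullet> v)) (at x0)" by (rule grad_has_derivative[OF diff[OF x0\<Omega>(1)]])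
  hence "(\<lambda>v. grad f x0 \<bullet> v) = (\<lambda>v. 0)"
    by (rule differential_zero_maxmin[OF x0\<Omega>(1) \<Omega>(1)]) (use nonneg x0\<Omega> in auto)
  hence f0: "(f has_derivative (\<lambda>v. 0)) (at x0)"
    using grad_has_derivative[OF diff[OF x0\<Omega>(1)]] by simp
  have W': "(W has_derivative (\<lambda>v. ((2 * \<epsilon> * k * exp (- k * r\<^sup>2)) *\<^sub>R (x0 - c)) \<bullet> v)) (at x0)"
  proof -
    have "((\<lambda>y. (y - c) \<bullet> (y - c)) has_derivative (\<lambda>v. 2 * ((x0 - c) \<bullet> v))) (at x0)"
      by (auto intro!: derivative_eq_intros simp: inner_commute)
    from has_derivative_compose[OF has_derivative_mult_right[OF this, of "- k"]
        DERIV_exp[unfolded has_field_derivative_def]]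
    have "((\<lambda>y. exp (- k * ((y - c) \<bullet> (y - c)))) has_derivative
        (\<lambda>v. exp (- k * r\<^sup>2) * (- k * (2 * ((x0 - c) \<bullet> v))))) (at x0)"
      by (simp only: ww)
    from has_derivative_diff[OF f0 has_derivative_mult_right[OF has_derivative_diff[OF this
          has_derivative_const[of "exp (- k * r\<^sup>2)"]], of \<epsilon>]]
    show ?thesis unfolding W_def[abs_def] by (simp add: mult_ac)
  qed
  have "((2 * \<epsilon> * k * exp (- k * r\<^sup>2)) *\<^sub>R (x0 - c)) \<bullet> w < 0"
  proof -
    have "(x0 - c) \<bullet> w = - r\<^sup>2" using ww by (simp add: w_def inner_diff_right)
    thus ?thesis using k r0 by simp
  qed
  from directional_derivative_sign[OF W' this]
  have "\<forall>\<^sub>F t in at_right 0. W (x0 + t *\<^sub>R w) < W x0" .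
  \<comment> \<open>Up to \<open>t = 1 / 2\<close> the point moving from \<open>x0\<close> to
    \<open>c\<close> keeps distance at least \<open>r / 2\<close> from \<open>c\<close>, hence stays
    in the annulus.\<close>
  moreover have "\<forall>\<^sub>F t in at_right (0::real). t < 1 / 2"
    by (auto simp: eventually_at_right_field intro: exI[of _ "1 / 2"])
  moreover have "\<forall>\<^sub>F t in at_right (0::real). t > 0"
    by (rule eventually_at_right_less)
  ultimately have "\<forall>\<^sub>F t::real in at_right 0. False"
  proof eventually_elim
    case (elim t)
    have "c - (x0 + t *\<^sub>R w) = (1 - t) *\<^sub>R (c - x0)" by (simp add: w_def algebra_simps)
    hence "dist c (x0 + t *\<^sub>R w) = (1 - t) * r" using elim by (simp add: dist_norm r_def)
    moreover have "(1 - t) * r \<le> r" "(1 - t) * r \<ge> r / 2"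
      using elim r0 mult_right_mono[of "1 / 2" "1 - t" r] mult_right_mono[of "1 - t" 1 r] by auto
    ultimately have "W (x0 + t *\<^sub>R w) \<ge> 0" using k(3)[of "x0 + t *\<^sub>R w"] by (simp add: W_def)
    moreover have "W x0 = 0" by (simp add: W_def x0\<Omega> ww)
    ultimately show False using elim by simp
  qed
  thus False by simp
qed

section \<open>The competition system\<close>

lemma partial_deriv_eq_line_derivative:
  assumes "f differentiable (at x)" "((\<lambda>t. f (x + t *\<^sub>R e)) has_real_derivative D) (at 0)"
  shows "partial_deriv e f x = D"
proof -
  have "(f has_derivative frechet_derivative f (at x)) (at x)"
    using assms(1) frechet_derivative_works by blast
  from has_real_derivative_along_line[OF this, of e] show ?thesis
    unfolding partial_deriv_def using assms(2) by (rule DERIV_unique)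
qed

lemma partial_deriv_along_line:
  assumes "f differentiable (at x)"
  shows "((\<lambda>t. f (x + t *\<^sub>R e)) has_real_derivative partial_deriv e f x) (at 0)"
  using has_real_derivative_along_line[of f "frechet_derivative f (at x)" x e] assms
    frechet_derivative_works unfolding partial_deriv_def by blast

lemma Ck_on_2D:
  assumes "Ck_on 2 f S" "open S"
  shows "x \<in> S \<Longrightarrow> f differentiable (at x)"
    and "e \<in> Basis \<Longrightarrow> x \<in> S \<Longrightarrow> partial_deriv e f differentiable (at x)"
    and "continuous_on S f"
    and "e \<in> Basis \<Longrightarrow> continuous_on S (partial_deriv e f)"
    and "e \<in> Basis \<Longrightarrow> continuous_on S (partial_deriv e (partial_deriv e f))"
proof -
  have *: "f differentiable_on S" "\<And>e. e \<in> Basis \<Longrightarrow> partial_deriv e f differentiable_on S"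
    "\<And>e. e \<in> Basis \<Longrightarrow> continuous_on S (partial_deriv e (partial_deriv e f))"
    using assms(1) by (auto simp: numeral_2_eq_2)
  show "x \<in> S \<Longrightarrow> f differentiable (at x)"
    "e \<in> Basis \<Longrightarrow> x \<in> S \<Longrightarrow> partial_deriv e f differentiable (at x)"
    using * assms(2) by (auto simp: differentiable_on_eq_differentiable_at)
  show "continuous_on S f" "e \<in> Basis \<Longrightarrow> continuous_on S (partial_deriv e f)"
    "e \<in> Basis \<Longrightarrow> continuous_on S (partial_deriv e (partial_deriv e f))"
    using * differentiable_imp_continuous_on by blast+
qed

text \<open>By the chain rule this is the derivative along \<open>e\<close> of
  \<open>(d + a * f) * f\<close>, written through \<open>f\<close> so that \<open>C^2\<close>
  regularity of \<open>f\<close> applies directly.\<close>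

definition flux :: "real \<Rightarrow> real \<Rightarrow> ('a::euclidean_space \<Rightarrow> real) \<Rightarrow> 'a \<Rightarrow> 'a \<Rightarrow> real" where
  "flux d a f e x = (d + 2 * a * f x) * partial_deriv e f x"

definition flux_deriv :: "real \<Rightarrow> real \<Rightarrow> ('a::euclidean_space \<Rightarrow> real) \<Rightarrow> 'a \<Rightarrow> 'a \<Rightarrow> real" where
  "flux_deriv d a f e x = 2 * a * (partial_deriv e f x)\<^sup>2
     + (d + 2 * a * f x) * partial_deriv e (partial_deriv e f) x"

lemma flux_calculus:
  fixes f :: "'a::euclidean_space \<Rightarrow> real" and d a :: real
  assumes f: "Ck_on 2 f S" "open S"
  defines "F \<equiv> \<lambda>y. (d + a * f y) * f y"
  shows "x \<in> S \<Longrightarrow> F differentiable (at x)"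
    and "e \<in> Basis \<Longrightarrow> x \<in> S \<Longrightarrow> ((\<lambda>t. F (x + t *\<^sub>R e)) has_real_derivative flux d a f e x) (at 0)"
    and "e \<in> Basis \<Longrightarrow> x \<in> S \<Longrightarrow>
      ((\<lambda>t. flux d a f e (x + t *\<^sub>R e)) has_real_derivative flux_deriv d a f e x) (at 0)"
    and "x \<in> S \<Longrightarrow> laplacian F x = (\<Sum>e\<in>Basis. flux_deriv d a f e x)"
    and "e \<in> Basis \<Longrightarrow> continuous_on S (flux d a f e)"
    and "e \<in> Basis \<Longrightarrow> continuous_on S (flux_deriv d a f e)"
proof -
  note C2 = Ck_on_2D[OF f]
  show F_diff: "F differentiable (at x)" if "x \<in> S" for x
    unfolding F_def by (intro derivative_intros C2(1) that)
  show F1: "((\<lambda>t. F (x + t *\<^sub>R e)) has_real_derivative flux d a f e x) (at 0)"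
    if "e \<in> Basis" "x \<in> S" for e x
    unfolding F_def flux_def
    using partial_deriv_along_line[OF C2(1)[OF that(2)], of e]
    by (auto intro!: derivative_eq_intros simp: algebra_simps)
  show F2: "((\<lambda>t. flux d a f e (x + t *\<^sub>R e)) has_real_derivative flux_deriv d a f e x) (at 0)"
    if "e \<in> Basis" "x \<in> S" for e x
    unfolding flux_def flux_deriv_def
    using partial_deriv_along_line[OF C2(1)[OF that(2)], of e]
      partial_deriv_along_line[OF C2(2)[OF that], of e]
    by (auto intro!: derivative_eq_intros simp: algebra_simps power2_eq_square)
  show "laplacian F x = (\<Sum>e\<in>Basis. flux_deriv d a f e x)" if x: "x \<in> S" for x
    unfolding laplacian_def
  proof (rule sum.cong[OF refl])
    fix e :: 'a assume e: "e \<in> Basis"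
    have eq: "partial_deriv e F y = flux d a f e y" if "y \<in> S" for y
      by (rule partial_deriv_eq_line_derivative[OF F_diff[OF that] F1[OF e that]])
    have diff: "flux d a f e differentiable (at x)"
      unfolding flux_def[abs_def] by (intro derivative_intros C2(1) C2(2) e x)
    \<comment> \<open>The two functions being differentiated are known to agree only on
      \<open>S\<close>; openness of \<open>S\<close> makes their derivatives at \<open>x\<close>
      coincide.\<close>
    have "partial_deriv e (flux d a f e) x = partial_deriv e (partial_deriv e F) x"
      unfolding partial_deriv_def[of e "flux d a f e"] partial_deriv_def[of e "partial_deriv e F"]
      using frechet_derivative_transform_within_open[OF diff f(2) x, of "partial_deriv e F"] eq by simp
    thus "partial_deriv e (partial_deriv e F) x = flux_deriv d a f e x"
      using partial_deriv_eq_line_derivative[OF diff F2[OF e x]] by simp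
  qed
  show "continuous_on S (flux d a f e)" "continuous_on S (flux_deriv d a f e)" if "e \<in> Basis" for e
    unfolding flux_def flux_deriv_def by (intro continuous_intros C2(3,4,5) that)+
qed

text \<open>Continuity gives a ball on which \<open>k\<close> exceeds half its value at
  \<open>x\<close>, and a ball has positive measure.\<close>

lemma integral_pos_if_pos_at:
  fixes k :: "'a::euclidean_space \<Rightarrow> real"
  assumes \<Omega>: "open \<Omega>" and cont: "continuous_on \<Omega> k"
    and int: "integrable lborel (\<lambda>x. indicator \<Omega> x * k x)"
    and nonneg: "\<And>x. x \<in> \<Omega> \<Longrightarrow> k x \<ge> 0" and x: "x \<in> \<Omega>" "k x > 0"
  shows "(\<integral>x. indicator \<Omega> x * k x \<partial>lborel) > 0"
proof -
  define c where "c = k x / 2"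
  have c: "0 < c" "c < k x" using x by (auto simp: c_def)
  have "open {y\<in>\<Omega>. k y > c}"
    using continuous_open_preimage[OF cont \<Omega> open_greaterThan, of c] by (simp add: vimage_def Int_def)
  then obtain r where r: "r > 0" "ball x r \<subseteq> {y\<in>\<Omega>. k y > c}"
    using x c by (metis (mono_tags, lifting) mem_Collect_eq open_contains_ball)
  have fin: "emeasure lborel (ball x r) < \<infinity>" by (rule emeasure_lborel_ball_finite)
  have int': "integrable lborel (\<lambda>y. indicator (ball x r) y * c)"
    using fin by (intro integrable_mult_left integrable_real_indicator) (auto simp: infinity_ennreal_def)
  have "0 < measure lborel (ball x r) * c"
    using content_ball_pos[OF r(1), of x] c by simp
  also have "\<dots> = (\<integral>y. indicator (ball x r) y * c \<partial>lborel)" by simp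
  also have "\<dots> \<le> (\<integral>y. indicator \<Omega> y * k y \<partial>lborel)"
  proof (rule integral_mono[OF int' int])
    fix y
    show "indicator (ball x r) y * c \<le> indicator \<Omega> y * k y"
    proof (cases "y \<in> ball x r")
      case True
      hence "y \<in> \<Omega>" "c < k y" using r(2) by blast+
      thus ?thesis using True by simp
    next
      case False
      thus ?thesis using nonneg by (cases "y \<in> \<Omega>") simp_all
    qed
  qed
  finally show ?thesis .
qed

section \<open>Upper bound and positivity of one species\<close>

text \<open>At a boundary maximum above 1 the Robin condition would make the normal derivative
  negative, against \<open>normal_deriv_nonneg_at_max\<close>. At an interior one the reaction term
  is negative and the Laplacian nonpositive, so they cannot cancel.\<close>

lemma Robin_species_le_1:
  fixes \<Omega> :: "'a::euclidean_space set" and v :: "'a \<Rightarrow> real"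
  assumes \<Omega>: "open \<Omega>" "bounded \<Omega>" "outward_unit_normal \<Omega> \<nu>"
    and par: "d > 0" "a \<ge> 0" "c \<ge> 0" "\<alpha> > 0" "\<beta> > 0"
    and v: "C1_closure v \<Omega>" "Ck_on 2 v \<Omega>" "\<And>x. x \<in> closure \<Omega> \<Longrightarrow> v x \<ge> 0"
    and u: "\<And>x. x \<in> closure \<Omega> \<Longrightarrow> u x \<ge> 0"
    and eq: "\<And>x. x \<in> \<Omega> \<Longrightarrow> laplacian (\<lambda>y. (d + a * v y) * v y) x + v x * (1 - c * u x - v x) = 0"
    and bc: "\<And>x. x \<in> frontier \<Omega> \<Longrightarrow> \<alpha> * v x + \<beta> * normal_deriv \<Omega> \<nu> v x = 0"
    and x: "x \<in> closure \<Omega>"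
  shows "v x \<le> 1"
proof (rule ccontr)
  assume "\<not> v x \<le> 1"
  have "\<exists>p\<in>closure \<Omega>. \<forall>y\<in>closure \<Omega>. v y \<le> v p"
  proof (rule continuous_attains_sup)
    show "compact (closure \<Omega>)" using \<Omega>(2) by (simp add: compact_closure)
    show "continuous_on (closure \<Omega>) v" using v(1) by (simp add: C1_closure_def)
    show "closure \<Omega> \<noteq> {}" using x by (rule ex_in_conv[THEN iffD1, OF exI])
  qed
  then obtain p where p: "p \<in> closure \<Omega>" "\<And>y. y \<in> closure \<Omega> \<Longrightarrow> v y \<le> v p" by (elim bexE) simp
  have vp: "v p > 1" using p(2)[OF x] \<open>\<not> v x \<le> 1\<close> by simp
  have sub: "y \<in> closure \<Omega>" if "y \<in> \<Omega>" for y using that closure_subset by blast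
  show False
  proof (cases "p \<in> \<Omega>")
    case False
    hence fr: "p \<in> frontier \<Omega>" using p(1) \<Omega>(1) by (simp add: frontier_def interior_open)
    have "normal_deriv \<Omega> \<nu> v p \<ge> 0"
      by (rule normal_deriv_nonneg_at_max[OF \<Omega>(1,3) v(1) fr]) (use p(2) sub in blast)
    hence "\<beta> * normal_deriv \<Omega> \<nu> v p \<ge> 0" using par by simp
    moreover have "\<alpha> * v p > 0" using par vp by simp
    ultimately show False using bc[OF fr] by simp
  next
    case True
    note fc = flux_calculus[OF v(2) \<Omega>(1), where d = d and a = a]
    have "- flux_deriv d a v e p \<ge> 0" if e: "e \<in> Basis" for e
    proof (rule second_derivative_nonneg_at_local_min[OF \<Omega>(1) True,
          where f = "\<lambda>y. - ((d + a * v y) * v y)" and e = e and ?f1.0 = "\<lambda>y. - flux d a v e y"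
            and ?f2.0 = "\<lambda>y. - flux_deriv d a v e y"])
      show "((\<lambda>t. - ((d + a * v (y + t *\<^sub>R e)) * v (y + t *\<^sub>R e))) has_real_derivative - flux d a v e y) (at 0)"
        if "y \<in> \<Omega>" for y by (rule DERIV_minus[OF fc(2)[OF e that]])
      show "((\<lambda>t. - flux d a v e (p + t *\<^sub>R e)) has_real_derivative - flux_deriv d a v e p) (at 0)"
        by (rule DERIV_minus[OF fc(3)[OF e True]])
      \<comment> \<open>Since \<open>(d + a * t) * t\<close> is nondecreasing for
        \<open>t \<ge> 0\<close>, the maximum of \<open>v\<close> is also one of the diffusion term,
        whose Laplacian enters the equation.\<close>
      show "- ((d + a * v p) * v p) \<le> - ((d + a * v y) * v y)" if y: "y \<in> \<Omega>" for y
      proof -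
        have "0 \<le> v y" "v y \<le> v p" using v(3) p(2) sub[OF y] by auto
        hence "(d + a * v y) * v y \<le> (d + a * v p) * v p"
          using par by (intro mult_mono add_mono mult_left_mono) auto
        thus ?thesis by simp
      qed
    qed
    hence "(\<Sum>e\<in>Basis. flux_deriv d a v e p) \<le> 0" by (intro sum_nonpos) force
    hence "v p * (1 - c * u p - v p) \<ge> 0" using eq[OF True] fc(4)[OF True] by simp
    moreover have "0 \<le> c * u p" using par u[OF p(1)] by simp
    with vp have "1 - c * u p - v p < 0" by simp
    hence "v p * (1 - c * u p - v p) < 0" using vp by (simp add: mult_pos_neg)
    ultimately show False by simp
  qed
qed

text \<open>The strong minimum principle is applied to \<open>(d + a * v) * v\<close>, whose
  Laplacian the equation controls: with \<open>u \<le> M\<close> and \<open>v \<le> 1\<close> it is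
  at most \<open>(c * M + 1) * v\<close>, and \<open>d * v \<le> (d + a * v) * v\<close> turns this
  into a multiple of the function itself.\<close>

lemma Robin_species_pos:
  fixes \<Omega> :: "'a::euclidean_space set" and u v :: "'a \<Rightarrow> real"
  assumes \<Omega>: "open \<Omega>" "bounded \<Omega>" "connected \<Omega>"
    and par: "d > 0" "a \<ge> 0" "c \<ge> 0"
    and v: "Ck_on 2 v \<Omega>" "\<And>x. x \<in> \<Omega> \<Longrightarrow> 0 \<le> v x \<and> v x \<le> 1"
    and u: "continuous_on (closure \<Omega>) u"
    and eq: "\<And>x. x \<in> \<Omega> \<Longrightarrow> laplacian (\<lambda>y. (d + a * v y) * v y) x + v x * (1 - c * u x - v x) = 0"
    and nz: "\<exists>x\<in>\<Omega>. v x \<noteq> 0" and x: "x \<in> \<Omega>"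
  shows "v x > 0"
proof -
  have "compact (closure \<Omega>)" using \<Omega>(2) by (simp add: compact_closure)
  then obtain M where M: "\<And>x. x \<in> closure \<Omega> \<Longrightarrow> \<bar>u x\<bar> \<le> M"
    using compact_imp_bounded[OF compact_continuous_image[OF u]]
    by (metis bounded_iff image_eqI real_norm_def)
  have uM: "u y \<le> M" "0 \<le> M" if "y \<in> \<Omega>" for y
    using M[of y] that closure_subset[of \<Omega>] by fastforce+
  note fc = flux_calculus[OF v(1) \<Omega>(1), where d = d and a = a]
  have M0: "M \<ge> 0" using uM(2)[OF x] .
  have "(d + a * v x) * v x > 0"
  proof (rule strong_minimum_principle[OF \<Omega>(1,3) _ fc(1) _ fc(2) fc(3) _ _ x, where C = "(c * M + 1) / d"])
    show "0 \<le> (c * M + 1) / d" using par M0 by simp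
    show "0 \<le> (d + a * v y) * v y" if "y \<in> \<Omega>" for y using v(2)[OF that] par by simp
    show "\<exists>x\<in>\<Omega>. (d + a * v x) * v x \<noteq> 0"
    proof -
      obtain y where y: "y \<in> \<Omega>" "v y \<noteq> 0" using nz by blast
      have "d + a * v y > 0" using v(2)[OF y(1)] par by (simp add: add_pos_nonneg)
      thus ?thesis using y by (intro bexI[of _ y]) auto
    qed
    show "(\<Sum>e\<in>Basis. flux_deriv d a v e y) \<le> (c * M + 1) / d * ((d + a * v y) * v y)" if y: "y \<in> \<Omega>" for y
    proof -
      have "(\<Sum>e\<in>Basis. flux_deriv d a v e y) = (c * u y + v y - 1) * v y"
        using eq[OF y] fc(4)[OF y] by (simp add: algebra_simps)
      also have "\<dots> \<le> (c * M + 1) * v y"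
      proof (rule mult_right_mono)
        have "c * u y \<le> c * M" using uM(1)[OF y] par by (simp add: mult_left_mono)
        thus "c * u y + v y - 1 \<le> c * M + 1" using v(2)[OF y] by simp
      qed (use v(2)[OF y] in simp)
      also have "\<dots> = (c * M + 1) / d * (d * v y)" using par by simp
      also have "\<dots> \<le> (c * M + 1) / d * ((d + a * v y) * v y)"
        using v(2)[OF y] par M0 by (intro mult_left_mono mult_right_mono) auto
      finally show ?thesis .
    qed
  qed
  thus ?thesis using v(2)[OF x] by (auto simp: less_le)
qed

text \<open>Picone's inequality in one coordinate direction: up to the square \<open>D2 (p - u q / w)\<^sup>2\<close>, the
  divergence of \<open>u \<nabla>U - (u\<^sup>2 / w) \<nabla>V\<close> only involves the Laplacians.\<close>
lemma Picone_inequality: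
  fixes D1 D2 u w p q A B :: real
  assumes "w > 0" "0 \<le> D2" "D2 \<le> D1"
  shows "u * A - u\<^sup>2 / w * B \<le>
    p * (D1 * p) + u * A - ((2 * u * p * w - u\<^sup>2 * q) / w\<^sup>2 * (D2 * q) + u\<^sup>2 / w * B)"
proof -
  have "0 \<le> (D1 - D2) * p\<^sup>2 + D2 * (p - u * q / w)\<^sup>2" using assms by simp
  also have "\<dots> = p * (D1 * p) - (2 * u * p * w - u\<^sup>2 * q) / w\<^sup>2 * (D2 * q)"
    using assms(1) by (simp add: field_simps power2_eq_square)
  finally show ?thesis by simp
qed

section \<open>Flux estimate and exclusion of coexistence\<close>

text \<open>The case in which \<open>v\<close> is the stronger competitor and \<open>u\<close>
  diffuses at least as fast and meets the more absorbing boundary; the other case is its mirror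
  image.\<close>

lemma no_coexistence:
  fixes \<Omega> :: "'a::euclidean_space set" and \<nu> :: "'a \<Rightarrow> 'a" and u v :: "'a \<Rightarrow> real"
  assumes dom: "smooth_bounded_domain \<Omega>" "outward_unit_normal \<Omega> \<nu>"
    and par: "a1 > 0" "a2 > 0" "d1 > 0" "d2 > 0" "a11 \<ge> 0" "a22 \<ge> 0"
      "\<alpha>1 > 0" "\<alpha>2 > 0" "\<beta>1 > 0" "\<beta>2 > 0"
    and sol: "nonneg_classical_solution \<Omega> \<nu> d1 d2 a11 a22 a1 a2 \<alpha>1 \<alpha>2 \<beta>1 \<beta>2 u v"
    and ineq: "a1 > 1" "1 > a2" "d1 \<ge> d2 + 2 * a22" "\<alpha>1 \<ge> \<beta>1" "\<alpha>2 \<le> \<beta>2"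
  shows "(\<forall>x\<in>\<Omega>. u x = 0) \<or> (\<forall>x\<in>\<Omega>. v x = 0)"
proof (rule ccontr)
  assume "\<not> ?thesis"
  then obtain x0 where x0: "x0 \<in> \<Omega>" "u x0 \<noteq> 0" and vnz: "\<exists>x\<in>\<Omega>. v x \<noteq> 0" by blast
  have \<Omega>: "open \<Omega>" "bounded \<Omega>" "smooth_boundary \<Omega>" "outward_unit_normal \<Omega> \<nu>" "connected \<Omega>"
    using dom by (auto simp: smooth_bounded_domain_def)
  have C: "C1_closure u \<Omega>" "Ck_on 2 u \<Omega>" "C1_closure v \<Omega>" "Ck_on 2 v \<Omega>"
    and nn: "\<And>x. x \<in> closure \<Omega> \<Longrightarrow> u x \<ge> 0" "\<And>x. x \<in> closure \<Omega> \<Longrightarrow> v x \<ge> 0"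
    and equ: "\<And>x. x \<in> \<Omega> \<Longrightarrow> laplacian (\<lambda>y. (d1 + a11 * u y) * u y) x + u x * (1 - u x - a1 * v x) = 0"
    and eqv: "\<And>x. x \<in> \<Omega> \<Longrightarrow> laplacian (\<lambda>y. (d2 + a22 * v y) * v y) x + v x * (1 - a2 * u x - v x) = 0"
    and bcu: "\<And>x. x \<in> frontier \<Omega> \<Longrightarrow> \<alpha>1 * u x + \<beta>1 * normal_deriv \<Omega> \<nu> u x = 0"
    and bcv: "\<And>x. x \<in> frontier \<Omega> \<Longrightarrow> \<alpha>2 * v x + \<beta>2 * normal_deriv \<Omega> \<nu> v x = 0"
    using sol by (auto simp: nonneg_classical_solution_def nonneg_classical_pair_def robin_system_def)
  have sub: "x \<in> closure \<Omega>" if "x \<in> \<Omega>" for x using that closure_subset by blast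
  have frc: "x \<in> closure \<Omega>" if "x \<in> frontier \<Omega>" for x using that by (simp add: frontier_def)
  have cc: "continuous_on (closure \<Omega>) u" "continuous_on (closure \<Omega>) v"
    using C by (auto simp: C1_closure_def)
  have co: "continuous_on \<Omega> u" "continuous_on \<Omega> v" using cc sub continuous_on_subset by blast+
  have v1: "v x \<le> 1" if "x \<in> closure \<Omega>" for x
    using Robin_species_le_1[OF \<Omega>(1,2,4) par(4,6) _ par(8,10) C(3,4) nn(2,1) eqv bcv that] par by auto
  have vpos: "v x > 0" if "x \<in> \<Omega>" for x
    using Robin_species_pos[OF \<Omega>(1,2,5) par(4,6) _ C(4) _ cc(1) eqv vnz that] nn(2) v1 sub par by auto
  obtain Gu where Gu: "continuous_on (closure \<Omega>) Gu" "\<And>x. x \<in> \<Omega> \<Longrightarrow> Gu x = grad u x"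
    using C(1) by (auto simp: C1_closure_def)
  obtain Gv where Gv: "continuous_on (closure \<Omega>) Gv" "\<And>x. x \<in> \<Omega> \<Longrightarrow> Gv x = grad v x"
    using C(3) by (auto simp: C1_closure_def)
  define f where "f x = 1 - u x - a1 * v x" for x
  define g where "g x = 1 - a2 * u x - v x" for x
  define K where "K x = u x ^ 2 * (g x - f x)" for x
  \<comment> \<open>Once the equations replace the Laplacians, \<open>k \<epsilon>\<close> is
    Picone's lower bound for the divergence of the field and \<open>K\<close> its pointwise limit.
    The shift by \<open>\<epsilon>\<close> keeps the denominator positive up to the boundary, where
    only \<open>v \<ge> 0\<close> is at hand.\<close>
  define k where "k \<epsilon> x = (u x)\<^sup>2 * g x * (v x / (v x + \<epsilon>)) - (u x)\<^sup>2 * f x" for \<epsilon> x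
  have compact: "compact (closure \<Omega>)" using \<Omega>(2) by (simp add: compact_closure)
  have "bounded ((\<lambda>x. \<bar>(u x)\<^sup>2 * g x\<bar> + \<bar>(u x)\<^sup>2 * f x\<bar>) ` closure \<Omega>)"
    unfolding f_def g_def
    by (intro compact_imp_bounded compact_continuous_image compact continuous_intros cc)
  then obtain M where M': "\<forall>y\<in>(\<lambda>x. \<bar>(u x)\<^sup>2 * g x\<bar> + \<bar>(u x)\<^sup>2 * f x\<bar>) ` closure \<Omega>. norm y \<le> M"
    unfolding bounded_iff ..
  have M: "\<bar>(u x)\<^sup>2 * g x\<bar> + \<bar>(u x)\<^sup>2 * f x\<bar> \<le> M" if "x \<in> closure \<Omega>" for x
    using bspec[OF M' imageI[OF that]] unfolding real_norm_def by linarith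
  have kM: "\<bar>k \<epsilon> x\<bar> \<le> M" if "x \<in> \<Omega>" "\<epsilon> > 0" for \<epsilon> x
  proof -
    have "0 \<le> v x / (v x + \<epsilon>)" "v x / (v x + \<epsilon>) \<le> 1" using vpos[OF that(1)] that(2) by auto
    hence "\<bar>(u x)\<^sup>2 * g x * (v x / (v x + \<epsilon>))\<bar> \<le> \<bar>(u x)\<^sup>2 * g x\<bar>"
      by (simp only: abs_mult[of "(u x)\<^sup>2 * g x"] abs_of_nonneg mult_left_le abs_ge_zero)
    thus ?thesis using M[OF sub[OF that(1)]] unfolding k_def by linarith
  qed
  have KM: "\<bar>K x\<bar> \<le> M" if "x \<in> \<Omega>" for x
    using M[OF sub[OF that]] unfolding K_def right_diff_distrib by linarith
  have ck: "continuous_on \<Omega> (k \<epsilon>)" if "\<epsilon> > 0" for \<epsilon>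
    unfolding k_def f_def g_def using vpos that
    by (intro continuous_intros co) (auto simp: add_pos_pos less_imp_neq[symmetric])
  have cK: "continuous_on \<Omega> K" unfolding K_def f_def g_def by (intro continuous_intros co)
  note fu = flux_calculus[OF C(2) \<Omega>(1), where d = d1 and a = a11]
  note fv = flux_calculus[OF C(4) \<Omega>(1), where d = d2 and a = a22]
  have D12: "0 \<le> d2 + 2 * a22 * v x" "d2 + 2 * a22 * v x \<le> d1 + 2 * a11 * u x" if "x \<in> closure \<Omega>" for x
  proof -
    have "a22 * v x \<le> a22" "0 \<le> a22 * v x" "0 \<le> a11 * u x"
      using v1[OF that] nn[OF that] par by (auto simp: mult_left_le)
    thus "0 \<le> d2 + 2 * a22 * v x" "d2 + 2 * a22 * v x \<le> d1 + 2 * a11 * u x"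
      using ineq(3) par by linarith+
  qed
  have le0: "(\<integral>x. indicator \<Omega> x * k \<epsilon> x \<partial>lborel) \<le> 0" if \<epsilon>: "\<epsilon> > 0" for \<epsilon>
  proof -
    \<comment> \<open>\<open>Gu\<close> and \<open>Gv\<close> stand in for the gradients so that the
      field is continuous up to the boundary; inside \<open>\<Omega>\<close> they are the
      gradients.\<close>
    define X where "X x = ((d1 + 2 * a11 * u x) * u x) *\<^sub>R Gu x
      - ((u x)\<^sup>2 / (v x + \<epsilon>) * (d2 + 2 * a22 * v x)) *\<^sub>R Gv x" for x
    define DX where "DX e x = partial_deriv e u x * flux d1 a11 u e x + u x * flux_deriv d1 a11 u e x
      - ((2 * u x * partial_deriv e u x * (v x + \<epsilon>) - (u x)\<^sup>2 * partial_deriv e v x) / (v x + \<epsilon>)\<^sup>2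
          * flux d2 a22 v e x + (u x)\<^sup>2 / (v x + \<epsilon>) * flux_deriv d2 a22 v e x)" for e x
    have ve: "v x + \<epsilon> > 0" if "x \<in> closure \<Omega>" for x using nn(2)[OF that] \<epsilon> by simp
    have ve0: "v x + \<epsilon> \<noteq> 0" if "x \<in> closure \<Omega>" for x using ve[OF that] by simp
    show ?thesis
    proof (rule divergence_inequality[OF \<Omega>(1,2,3,4), where X = X and DX = DX and M = M])
      show "continuous_on (closure \<Omega>) X"
        unfolding X_def using ve0 by (intro continuous_intros cc Gu Gv) auto
    next
      fix e :: 'a assume e: "e \<in> Basis"
      note C2 = Ck_on_2D[OF C(2) \<Omega>(1)] Ck_on_2D[OF C(4) \<Omega>(1)]
      show "continuous_on \<Omega> (DX e)"
        unfolding DX_def using ve0[OF sub]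
        by (intro continuous_intros co fu(5,6) fv(5,6) C2(4,9) e) auto
      fix x assume x: "x \<in> \<Omega>"
      have "\<forall>\<^sub>F t in nhds 0. X (x + t *\<^sub>R e) \<bullet> e = u (x + t *\<^sub>R e) * flux d1 a11 u e (x + t *\<^sub>R e)
          - (u (x + t *\<^sub>R e))\<^sup>2 / (v (x + t *\<^sub>R e) + \<epsilon>) * flux d2 a22 v e (x + t *\<^sub>R e)"
        using eventually_along_line[OF \<Omega>(1) x, of e]
      proof eventually_elim
        case (elim t)
        show ?case
          using Gu(2)[OF elim] Gv(2)[OF elim] e
          by (simp add: X_def flux_def inner_diff_left grad_inner_Basis mult_ac)
      qed
      moreover have "((\<lambda>t. u (x + t *\<^sub>R e) * flux d1 a11 u e (x + t *\<^sub>R e)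
          - (u (x + t *\<^sub>R e))\<^sup>2 / (v (x + t *\<^sub>R e) + \<epsilon>) * flux d2 a22 v e (x + t *\<^sub>R e))
          has_real_derivative DX e x) (at 0)"
      proof -
        note du = partial_deriv_along_line[OF C2(1)[OF x], of e]
        note dv = partial_deriv_along_line[OF C2(6)[OF x], of e]
        have "((\<lambda>t. (u (x + t *\<^sub>R e))\<^sup>2 / (v (x + t *\<^sub>R e) + \<epsilon>)) has_real_derivative
            (2 * u x * partial_deriv e u x * (v x + \<epsilon>) - (u x)\<^sup>2 * partial_deriv e v x) / (v x + \<epsilon>)\<^sup>2) (at 0)"
          using ve0[OF sub[OF x]]
          by (auto intro!: derivative_eq_intros du dv simp: power2_eq_square algebra_simps)
        from DERIV_diff[OF DERIV_mult[OF du fu(3)[OF e x]] DERIV_mult[OF this fv(3)[OF e x]]]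
        show ?thesis by (simp add: DX_def algebra_simps)
      qed
      ultimately show "((\<lambda>t. X (x + t *\<^sub>R e) \<bullet> e) has_real_derivative DX e x) (at 0)"
        by (subst DERIV_cong_ev[OF refl _ refl]) auto
    next
      fix q assume q: "q \<in> frontier \<Omega>"
      note qc = frc[OF q]
      define D1 D2 where "D1 = d1 + 2 * a11 * u q" and "D2 = d2 + 2 * a22 * v q"
      have D: "0 \<le> D2" "D2 \<le> D1" using D12[OF qc] by (auto simp: D1_def D2_def)
      have nu: "Gu q \<bullet> \<nu> q = - (\<alpha>1 / \<beta>1) * u q"
        using bcu[OF q] par boundary_grad_eq[OF \<Omega>(1) q Gu] by (simp add: normal_deriv_def field_simps)
      have nv: "Gv q \<bullet> \<nu> q = - (\<alpha>2 / \<beta>2) * v q"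
        using bcv[OF q] par boundary_grad_eq[OF \<Omega>(1) q Gv] by (simp add: normal_deriv_def field_simps)
      \<comment> \<open>In the bracket the first term is at most \<open>D2\<close>, since
        \<open>\<alpha>2 / \<beta>2\<close> and \<open>v q / (v q + \<epsilon>)\<close> are at most
        1; the second is at least \<open>D1\<close>, since \<open>\<alpha>1 / \<beta>1\<close> is at
        least 1; and \<open>D2 \<le> D1\<close>.\<close>
      have "X q \<bullet> \<nu> q = (u q)\<^sup>2 * (D2 * ((\<alpha>2 / \<beta>2) * (v q / (v q + \<epsilon>))) - D1 * (\<alpha>1 / \<beta>1))"
        unfolding X_def inner_diff_left inner_scaleR_left nu nv D1_def[symmetric] D2_def[symmetric]
        by (simp add: power2_eq_square right_diff_distrib mult_ac)
      moreover have "D2 * ((\<alpha>2 / \<beta>2) * (v q / (v q + \<epsilon>))) \<le> D2 * (1 * 1)"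
        using D nn(2)[OF qc] \<epsilon> par ineq
        by (intro mult_left_mono mult_mono) (auto simp: divide_le_eq)
      moreover have "D1 * 1 \<le> D1 * (\<alpha>1 / \<beta>1)"
        using D par ineq by (intro mult_left_mono) (auto simp: le_divide_eq)
      ultimately show "X q \<bullet> \<nu> q \<le> 0" using D by (simp add: mult_nonneg_nonpos)
    next
      fix x assume x: "x \<in> \<Omega>"
      have "k \<epsilon> x = u x * (\<Sum>e\<in>Basis. flux_deriv d1 a11 u e x)
          - (u x)\<^sup>2 / (v x + \<epsilon>) * (\<Sum>e\<in>Basis. flux_deriv d2 a22 v e x)"
      proof -
        have "(\<Sum>e\<in>Basis. flux_deriv d1 a11 u e x) = - u x * f x"
          "(\<Sum>e\<in>Basis. flux_deriv d2 a22 v e x) = - v x * g x"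
          using equ[OF x] eqv[OF x] fu(4)[OF x] fv(4)[OF x] by (simp_all add: f_def g_def)
        thus ?thesis by (simp add: k_def power2_eq_square)
      qed
      also have "\<dots> = (\<Sum>e\<in>Basis. u x * flux_deriv d1 a11 u e x - (u x)\<^sup>2 / (v x + \<epsilon>) * flux_deriv d2 a22 v e x)"
        by (simp only: sum_distrib_left sum_subtractf)
      \<comment> \<open>Picone's inequality in each coordinate, with \<open>v x + \<epsilon>\<close>
        as \<open>w\<close> and the partial derivatives of \<open>u\<close> and \<open>v\<close> as
        \<open>p\<close> and \<open>q\<close>; \<open>D12\<close> orders the two diffusion
        coefficients.\<close>
      also have "\<dots> \<le> (\<Sum>e\<in>Basis. DX e x)"
        unfolding DX_def flux_def
        by (intro sum_mono Picone_inequality ve D12 sub x)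
      finally show "k \<epsilon> x \<le> (\<Sum>e\<in>Basis. DX e x)" .
    qed (use ck kM \<epsilon> in auto)
  qed
  define \<tau> where "\<tau> n = inverse (real (Suc n))" for n
  have \<tau>: "\<tau> n > 0" for n by (simp add: \<tau>_def)
  have "(\<lambda>n. \<integral>x. indicator \<Omega> x * k (\<tau> n) x \<partial>lborel) \<longlonglongrightarrow> (\<integral>x. indicator \<Omega> x * K x \<partial>lborel)"
  proof (rule integral_dominated_convergence)
    show "integrable lborel (\<lambda>x. indicator \<Omega> x * M)"
      by (rule integrable_indicator_continuous_bounded[OF \<Omega>(1,2), of _ "\<bar>M\<bar>"]) auto
    show "(\<lambda>x. indicator \<Omega> x * K x) \<in> borel_measurable lborel"
      using integrable_indicator_continuous_bounded[OF \<Omega>(1,2) cK KM] by (rule borel_measurable_integrable)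
    show "(\<lambda>x. indicator \<Omega> x * k (\<tau> n) x) \<in> borel_measurable lborel" for n
      using integrable_indicator_continuous_bounded[OF \<Omega>(1,2) ck[OF \<tau>] kM[OF _ \<tau>]]
      by (rule borel_measurable_integrable)
    show "AE x in lborel. norm (indicator \<Omega> x * k (\<tau> n) x) \<le> indicator \<Omega> x * M" for n
    proof (rule AE_I2)
      show "norm (indicator \<Omega> x * k (\<tau> n) x) \<le> indicator \<Omega> x * M" for x
        using kM[of x "\<tau> n"] \<tau> by (cases "x \<in> \<Omega>") simp_all
    qed
    show "AE x in lborel. (\<lambda>n. indicator \<Omega> x * k (\<tau> n) x) \<longlonglongrightarrow> indicator \<Omega> x * K x"
    proof (rule AE_I2)
      show "(\<lambda>n. indicator \<Omega> x * k (\<tau> n) x) \<longlonglongrightarrow> indicator \<Omega> x * K x" for x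
      proof (cases "x \<in> \<Omega>")
        case True
        have "\<tau> \<longlonglongrightarrow> 0" unfolding \<tau>_def[abs_def] by (rule LIMSEQ_inverse_real_of_nat)
        \<comment> \<open>Strict positivity of \<open>v\<close> enters here: the quotient
          \<open>v x / (v x + \<tau> n)\<close> tends to 1.\<close>
        hence "(\<lambda>n. k (\<tau> n) x) \<longlonglongrightarrow> (u x)\<^sup>2 * g x * (v x / (v x + 0)) - (u x)\<^sup>2 * f x"
          unfolding k_def using vpos[OF True] by (intro tendsto_intros) auto
        thus ?thesis using True vpos[OF True] by (simp add: K_def right_diff_distrib)
      qed simp
    qed
  qed
  hence "(\<integral>x. indicator \<Omega> x * K x \<partial>lborel) \<le> 0"
    by (rule LIMSEQ_le_const2) (use le0 \<tau> in auto)
  moreover have gf: "g x - f x > 0" if "x \<in> \<Omega>" for x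
  proof -
    have "g x - f x = (1 - a2) * u x + (a1 - 1) * v x" by (simp add: f_def g_def algebra_simps)
    thus ?thesis using ineq nn(1)[OF sub[OF that]] vpos[OF that] by (simp add: add_nonneg_pos)
  qed
  \<comment> \<open>\<open>K\<close> is nonnegative on \<open>\<Omega>\<close> and positive at
    \<open>x0\<close>, where \<open>u\<close> does not vanish, which contradicts the limit of the
    flux estimates.\<close>
  hence "(\<integral>x. indicator \<Omega> x * K x \<partial>lborel) > 0"
    using x0 by (intro integral_pos_if_pos_at[OF \<Omega>(1) cK
          integrable_indicator_continuous_bounded[OF \<Omega>(1,2) cK KM] _ x0(1)])
      (auto simp: K_def less_imp_le)
  ultimately show False by simp
qed

text \<open>Exchanging the species together with all their coefficients permutes the equations; this
  turns the second alternative into the first.\<close>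

lemma nonneg_classical_solution_swap:
  "nonneg_classical_solution \<Omega> \<nu> d1 d2 a11 a22 a1 a2 \<alpha>1 \<alpha>2 \<beta>1 \<beta>2 u v \<longleftrightarrow>
   nonneg_classical_solution \<Omega> \<nu> d2 d1 a22 a11 a2 a1 \<alpha>2 \<alpha>1 \<beta>2 \<beta>1 v u"
  by (auto simp: nonneg_classical_solution_def nonneg_classical_pair_def robin_system_def algebra_simps)

theorem theorem3p3:
  fixes \<Omega> :: "'a::euclidean_space set" and \<nu> :: "'a \<Rightarrow> 'a"
    and u v :: "'a \<Rightarrow> real"
    and d1 d2 a11 a22 a1 a2 \<alpha>1 \<alpha>2 \<beta>1 \<beta>2 :: real
  assumes "smooth_bounded_domain \<Omega>" and "outward_unit_normal \<Omega> \<nu>"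
    and "a1 > 0" and "a2 > 0" and "d1 > 0" and "d2 > 0" and "a11 \<ge> 0" and "a22 \<ge> 0"
    and "\<alpha>1 > 0" and "\<alpha>2 > 0" and "\<beta>1 > 0" and "\<beta>2 > 0"
    and "nonneg_classical_solution \<Omega> \<nu> d1 d2 a11 a22 a1 a2 \<alpha>1 \<alpha>2 \<beta>1 \<beta>2 u v"
    and "(a1 > 1 \<and> 1 > a2 \<and> d1 > d2 \<and> d1 \<ge> d2 + 2 * a22 \<and> \<alpha>1 \<ge> \<beta>1 \<and> \<alpha>2 \<le> \<beta>2) \<or>
         (a1 < 1 \<and> 1 < a2 \<and> d1 < d2 \<and> d2 \<ge> d1 + 2 * a11 \<and> \<alpha>1 \<le> \<beta>1 \<and> \<alpha>2 \<ge> \<beta>2)"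
  shows "\<not> coexisting_solution \<Omega> \<nu> d1 d2 a11 a22 a1 a2 \<alpha>1 \<alpha>2 \<beta>1 \<beta>2 u v \<and>
         ((\<forall>x\<in>\<Omega>. u x = 0) \<or> (\<forall>x\<in>\<Omega>. v x = 0))"
proof -
  have z: "(\<forall>x\<in>\<Omega>. u x = 0) \<or> (\<forall>x\<in>\<Omega>. v x = 0)"
    using assms(14)
  proof
    assume "a1 > 1 \<and> 1 > a2 \<and> d1 > d2 \<and> d1 \<ge> d2 + 2 * a22 \<and> \<alpha>1 \<ge> \<beta>1 \<and> \<alpha>2 \<le> \<beta>2"
    thus ?thesis by (intro no_coexistence[OF assms(1-13)]) auto
  next
    assume "a1 < 1 \<and> 1 < a2 \<and> d1 < d2 \<and> d2 \<ge> d1 + 2 * a11 \<and> \<alpha>1 \<le> \<beta>1 \<and> \<alpha>2 \<ge> \<beta>2"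
    hence "(\<forall>x\<in>\<Omega>. v x = 0) \<or> (\<forall>x\<in>\<Omega>. u x = 0)"
      by (intro no_coexistence[OF assms(1,2,4,3,6,5,8,7,10,9,12,11)
            assms(13)[unfolded nonneg_classical_solution_swap[of \<Omega> \<nu> d1]]]) auto
    thus ?thesis by blast
  qed
  have c: "continuous_on (closure \<Omega>) u" "continuous_on (closure \<Omega>) v"
    using assms(13) by (auto simp: nonneg_classical_solution_def nonneg_classical_pair_def C1_closure_def)
  \<comment> \<open>Coexistence is phrased on the closure, while vanishing is so far known in the
    open domain; continuity bridges the two.\<close>
  have "(\<forall>x\<in>closure \<Omega>. u x = 0) \<or> (\<forall>x\<in>closure \<Omega>. v x = 0)"
    using z
  proof
    assume 0: "\<forall>x\<in>\<Omega>. u x = 0"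
    have "u x = 0" if "x \<in> closure \<Omega>" for x
      by (rule continuous_constant_on_closure[OF c(1) _ that]) (use 0 in simp)
    thus ?thesis by simp
  next
    assume 0: "\<forall>x\<in>\<Omega>. v x = 0"
    have "v x = 0" if "x \<in> closure \<Omega>" for x
      by (rule continuous_constant_on_closure[OF c(2) _ that]) (use 0 in simp)
    thus ?thesis by simp
  qed
  thus ?thesis using z by (auto simp: coexisting_solution_def)
qed

end
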